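(* Let $f\in\mathcal{C}^2(\mathbb{R}^2)$ be supported in $\mathbb{B}^\circ$, let $M,N\in\mathbb{N}$ and $\phi\in[0,2\pi)$. Then $$\left\|S_{M,N}^{K}(R_\phi f)-R_\phi S_{M,N}^{K}(f)\right\|_\infty=\mathcal{O}(1/K)\qquad\text{for } K\ge K[M,N],$$ that is, there is a constant $A>0$ such that the left-hand side is at most $A/K$ for every $K\in\mathbb{N}$ with $K\ge K[M,N]$.
   Context: $\mathbb{N}=\{1,2,\dots\}$. $\mathbb{B}^\circ$ is the open unit disk of $\mathbb{R}^2$; $\mathrm{supp}(f)=\{\mathbf{x}: f(\mathbf{x})\neq 0\}$ and $f$ is supported in $X$ if $\mathrm{supp}(f)\subseteq X$. $\|f\|_\infty=\sup_{\mathbf{x}}|f(\mathbf{x})|$. $\mathcal{C}^q(\mathbb{R}^2)$ is the set of functions $\mathbb{R}^2\to\mathbb{C}$ all of whose partial derivatives of order $\le q$ exist and are continuous. For a function $h$ on $\mathbb{R}^2$, $R_\phi h(r,\theta):=h(r,\theta+\phi)$ in polar coordinates. Bessel notation: $J_m$ is the Bessel function of the first kind of order $m\in\mathbb{Z}$, $0<z_{m,1}<z_{m,2}<\cdots$ are its positive zeros, $K_{m,n}:=\lceil z_{m,n}/\pi\rceil$, and $K[M,N]:=\max\{K_{m,n}:0\le m\le M,\ 1\le n\le N\}$. In polar coordinates, $\Psi_{m,n}(r,\theta)=\frac{e^{\mathrm{i}m\theta}J_m(z_{m,n}r)}{\sqrt{\pi}\,|J_{m+1}(z_{m,n})|}$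 if $r\le 1$, and $0$ if $r>1$. Finite Fourier transform: for $L\in\mathbb{N}$, $\mathbf{k}\in\mathbb{Z}^2$, $\widehat f(\mathbf{k};L)=\delta^2\sum_{i=1}^L\sum_{j=1}^L f(x_i,x_j)e^{-\pi\mathrm{i}(k_1x_i+k_2x_j)}$ with $\delta=2/L$, $x_i=-1+(i-1)\delta$ (here $f(x_i,x_j)$ is in Cartesian coordinates). Coefficients: for $\mathbf{k}=(k_1,k_2)\in\mathbb{Z}^2$, $\mathbf{c}(\mathbf{k};m,n)=\varepsilon_m\sqrt{\pi}(-1)^n\mathrm{i}^m z_{m,n}\frac{J_m(\pi\|\mathbf{k}\|_2)e^{-\mathrm{i}m\Phi(\mathbf{k})}}{2(\pi^2\|\mathbf{k}\|_2^2-z_{m,n}^2)}$, where $\varepsilon_m=1$ if $m\ge0$, $\varepsilon_m=(-1)^m$ if $m<0$, and $\Phi(\mathbf{k})=\mathrm{atan2}(k_2,k_1)$ is the polar angle of $\mathbf{k}$ (with value $0$ at $\mathbf{k}=0$). If $\pi\|\mathbf{k}\|_2=z_{m,n}$, the quotient $J_m(\pi\|\mathbf{k}\|_2)/(\pi^2\|\mathbf{k}\|_2^2-z_{m,n}^2)$ is understood as its limiting value $J_m'(z_{m,n})/(2z_{m,n})$. Finite and inverse finite Fourier-Bessel transforms of order $K\in\mathbb{N}$: $C_{m,n}^K(f)=\sum_{\mathbf{k}\in\mathbb{Z}^2,\ \|\mathbf{k}\|_\infty\le K}\mathbf{c}(\mathbf{k};m,n)\,\widehat f(\mathbf{k};2K+1)$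 and $S_{M,N}^K(f)=\sum_{m=-M}^M\sum_{n=1}^N C_{m,n}^K(f)\Psi_{m,n}$. *)

theory Defs
  imports "HOL-Analysis.Analysis"
begin

text \<open>The plane is \<open>real \<times> real\<close> (Euclidean norm). The principal argument \<open>Arg\<close> is atan2,
  with \<open>Arg 0 = 0\<close>.\<close>

definition polar_angle :: "real \<times> real \<Rightarrow> real" where
  "polar_angle p = Arg (Complex (fst p) (snd p))"

definition from_polar :: "real \<Rightarrow> real \<Rightarrow> real \<times> real" where
  "from_polar r \<theta> = (r * cos \<theta>, r * sin \<theta>)"

definition rotate_fun :: "real \<Rightarrow> (real \<times> real \<Rightarrow> complex) \<Rightarrow> real \<times> real \<Rightarrow> complex" where
  "rotate_fun \<phi> h p = h (from_polar (norm p) (polar_angle p + \<phi>))"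

definition supported_in :: "(real \<times> real \<Rightarrow> complex) \<Rightarrow> (real \<times> real) set \<Rightarrow> bool" where
  "supported_in f X \<longleftrightarrow> {p. f p \<noteq> 0} \<subseteq> X"

text \<open>Extended-real valued, so that the supremum is meaningful without assuming boundedness.\<close>

definition sup_norm :: "(real \<times> real \<Rightarrow> complex) \<Rightarrow> ereal" where
  "sup_norm f = (SUP p. ereal (norm (f p)))"

text \<open>All partial derivatives of order at most \<open>q\<close> exist and are continuous; \<open>f1\<close> and \<open>f2\<close> are the
  first-order partial derivatives.\<close>

fun C_diff :: "nat \<Rightarrow> (real \<times> real \<Rightarrow> complex) \<Rightarrow> bool" where
  "C_diff 0 f \<longleftrightarrow> continuous_on UNIV f"
| "C_diff (Suc q) f \<longleftrightarrow> continuous_on UNIV f \<and>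
     (\<exists>f1 f2.
        (\<forall>x y. ((\<lambda>t. f (t, y)) has_vector_derivative f1 (x, y)) (at x)) \<and>
        (\<forall>x y. ((\<lambda>t. f (x, t)) has_vector_derivative f2 (x, y)) (at y)) \<and>
        C_diff q f1 \<and> C_diff q f2)"

text \<open>Defining power series of \<open>J\<^sub>m\<close>. For \<open>m < 0\<close> the reciprocal Gamma function vanishes
  for \<open>k < -m\<close>, so only nonnegative powers of \<open>x / 2\<close> contribute.\<close>

definition bessel_J :: "int \<Rightarrow> real \<Rightarrow> real" where
  "bessel_J m x =
     (\<Sum>k. (-1) ^ k / fact k * rGamma (real k + of_int m + 1) * (x / 2) powi (2 * int k + m))"

text \<open>The \<open>n\<close>-th positive zero of \<open>J\<^sub>m\<close>, meaningful for \<open>n \<ge> 1\<close>: the zero \<open>z > 0\<close> with exactly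
  \<open>n\<close> zeros in the half-open interval from \<open>0\<close> (excluded) to \<open>z\<close> (included).\<close>

definition bessel_zero :: "int \<Rightarrow> nat \<Rightarrow> real" where
  "bessel_zero m n =
     (THE z. 0 < z \<and> bessel_J m z = 0 \<and> card {y. 0 < y \<and> y \<le> z \<and> bessel_J m y = 0} = n)"

definition K_order :: "int \<Rightarrow> nat \<Rightarrow> int" where
  "K_order m n = \<lceil>bessel_zero m n / pi\<rceil>"

definition K_max :: "nat \<Rightarrow> nat \<Rightarrow> int" where
  "K_max M N = Max {K_order (int m) n | m n. m \<le> M \<and> 1 \<le> n \<and> n \<le> N}"

definition fb_Psi :: "int \<Rightarrow> nat \<Rightarrow> real \<times> real \<Rightarrow> complex" where
  "fb_Psi m n p =
     (if norm p \<le> 1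
      then exp (\<i> * of_int m * of_real (polar_angle p))
             * of_real (bessel_J m (bessel_zero m n * norm p))
             / of_real (sqrt pi * \<bar>bessel_J (m + 1) (bessel_zero m n)\<bar>)
      else 0)"

definition fin_fourier :: "(real \<times> real \<Rightarrow> complex) \<Rightarrow> int \<times> int \<Rightarrow> nat \<Rightarrow> complex" where
  "fin_fourier f k L =
     (let \<delta> = 2 / real L; x = (\<lambda>i::nat. -1 + (real i - 1) * \<delta>)
      in of_real (\<delta>\<^sup>2) *
         (\<Sum>i=1..L. \<Sum>j=1..L.
            f (x i, x j) * exp (- of_real pi * \<i> *
              (of_int (fst k) * of_real (x i) + of_int (snd k) * of_real (x j)))))"

definition freq_vec :: "int \<times> int \<Rightarrow> real \<times> real" where
  "freq_vec k = (of_int (fst k), of_int (snd k))"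

text \<open>\<open>J\<^sub>m(a) / (a\<^sup>2 - z\<^sup>2)\<close>, with its limiting value at \<open>a = z\<close>, where \<open>z\<close> is a
  positive zero of \<open>J\<^sub>m\<close>.\<close>

definition bessel_quot :: "int \<Rightarrow> real \<Rightarrow> real \<Rightarrow> real" where
  "bessel_quot m z a =
     (if a = z then deriv (bessel_J m) z / (2 * z) else bessel_J m a / (a\<^sup>2 - z\<^sup>2))"

definition fb_eps :: "int \<Rightarrow> complex" where
  "fb_eps m = (if m \<ge> 0 then 1 else (-1) powi m)"

definition fb_coeff :: "int \<times> int \<Rightarrow> int \<Rightarrow> nat \<Rightarrow> complex" where
  "fb_coeff k m n =
     fb_eps m * of_real (sqrt pi) * (-1) ^ n * \<i> powi m * of_real (bessel_zero m n)
       * of_real (bessel_quot m (bessel_zero m n) (pi * norm (freq_vec k)))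
       * exp (- \<i> * of_int m * of_real (polar_angle (freq_vec k))) / 2"

text \<open>The index set is the set of all \<open>k\<close> whose maximum norm is at most \<open>K\<close>.\<close>

definition fb_transform :: "nat \<Rightarrow> int \<Rightarrow> nat \<Rightarrow> (real \<times> real \<Rightarrow> complex) \<Rightarrow> complex" where
  "fb_transform K m n f =
     (\<Sum>k\<in>{- int K..int K} \<times> {- int K..int K}. fb_coeff k m n * fin_fourier f k (2 * K + 1))"

definition fb_inverse ::
    "nat \<Rightarrow> nat \<Rightarrow> nat \<Rightarrow> (real \<times> real \<Rightarrow> complex) \<Rightarrow> real \<times> real \<Rightarrow> complex" where
  "fb_inverse M N K f p =
     (\<Sum>m = - int M..int M. \<Sum>n = 1..N. fb_transform K m n f * fb_Psi m n p)"

end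

theory Submission
  imports Defs
begin

text \<open>
  With \<open>L = 2 * K + 1\<close>, the sum \<open>\<Sum>\<^sub>k f\<^sup>\<and>(k; L) e\<^sub>k / 4\<close> is the trigonometric polynomial interpolating \<open>f\<close> on the
  grid, and the coefficient \<open>c(k; m, n)\<close> is, up to a factor independent of \<open>k\<close>, the integral \<open>I(e\<^sub>k)\<close>, where
  \<open>I(F)\<close> integrates \<open>F(r, \<theta>) e\<^sup>-\<^sup>i\<^sup>m\<^sup>\<theta> J\<^sub>m(z r) r\<close> over the unit disk in polar coordinates: the angular integral is
  Bessel's integral and the radial one Lommel's. Hence the finite Fourier-Bessel transform of \<open>f\<close> is a constant times
  \<open>I\<close> of the interpolant. Since \<open>I\<close> turns a rotation into the factor \<open>e\<^sup>i\<^sup>m\<^sup>\<phi>\<close>, exactly as \<open>\<Psi>\<^sub>m\<^sub>,\<^sub>n\<close> does, the claim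
  reduces to a uniform interpolation error \<open>O(1/K)\<close> for \<open>f\<close> and for the rotated \<open>f\<close>.

  For the latter, the Parseval identity applied to cyclic second differences bounds \<open>\<Sum>\<^sub>k |k|\<^sup>4 |f\<^sup>\<and>(k; L)|\<^sup>2\<close>
  uniformly in \<open>L\<close>. Passing from the grid of size \<open>L\<close> to the nested grid of size \<open>3 * L\<close> only redistributes aliased
  frequencies of norm at least \<open>L / 2\<close>, so by Cauchy-Schwarz it changes the interpolant by \<open>O(1/L)\<close>. Iterating gives a
  geometric series, and the nested grids are dense.
\<close>

section \<open>Trigonometric interpolation\<close>

definition wave :: "int \<Rightarrow> real \<Rightarrow> complex" where
  "wave k x = cis (pi * of_int k * x)"

text \<open>Indices start at 0 here, so \<open>grid L i\<close> is the node with index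
  \<open>i + 1\<close> in \<open>fin_fourier\<close>. The node 1 itself is left out; by periodicity
  it is identified with -1.\<close>

definition grid :: "nat \<Rightarrow> nat \<Rightarrow> real" where
  "grid L i = - 1 + 2 * real i / real L"

definition plane_wave :: "int \<times> int \<Rightarrow> real \<times> real \<Rightarrow> complex" where
  "plane_wave k p = wave (fst k) (fst p) * wave (snd k) (snd p)"

definition freq_box :: "nat \<Rightarrow> (int \<times> int) set" where
  "freq_box K = {- int K..int K} \<times> {- int K..int K}"

lemma finite_freq_box [simp]: "finite (freq_box K)"
  by (simp add: freq_box_def)

lemma norm_wave [simp]: "norm (wave k x) = 1"
  by (simp add: wave_def)

lemma norm_plane_wave [simp]: "norm (plane_wave k p) = 1"
  by (simp add: plane_wave_def norm_mult)

lemma wave_0 [simp]: "wave 0 x = 1"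
  by (simp add: wave_def)

lemma wave_freq_add: "wave (j + k) x = wave j x * wave k x"
  by (simp add: wave_def cis_mult algebra_simps)

lemma wave_add: "wave k (x + y) = wave k x * wave k y"
  by (simp add: wave_def cis_mult algebra_simps)

lemma cnj_wave: "cnj (wave k x) = wave (- k) x"
  by (simp add: wave_def cis_cnj)

lemma wave_period: "wave k (2 * of_int d) = 1"
proof -
  have "pi * of_int k * (2 * of_int d) = 2 * pi * of_int (k * d)"
    by simp
  then show ?thesis
    unfolding wave_def by (metis cis_multiple_2pi Ints_of_int)
qed

section \<open>Discrete orthogonality, interpolation and Parseval\<close>

text \<open>A geometric sum that telescopes: multiplying by \<open>wave 1 y\<close> moves each
  frequency up by one, and passing from \<open>K\<close> to \<open>K + 1\<close> adds the two outer
  frequencies.\<close>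

lemma wave_geometric:
  "(wave 1 y - 1) * (\<Sum>k = - int K..int K. wave k y) = wave (int K + 1) y - wave (- int K) y"
proof (induction K)
  case 0
  then show ?case by simp
next
  case (Suc K)
  have "{- int (Suc K)..int (Suc K)} = insert (- int K - 1) (insert (int K + 1) {- int K..int K})"
    by auto
  then have "(\<Sum>k = - int (Suc K)..int (Suc K). wave k y)
      = wave (- int K - 1) y + wave (int K + 1) y + (\<Sum>k = - int K..int K. wave k y)"
    by simp
  moreover have "wave 1 y * wave (- int K - 1) y = wave (- int K) y"
    by (simp flip: wave_freq_add)
  moreover have "wave 1 y * wave (int K + 1) y = wave (int (Suc K) + 1) y"
    by (simp add: algebra_simps flip: wave_freq_add)
  moreover have "wave (- int (Suc K)) y = wave (- int K - 1) y"
    by (rule arg_cong2[where f=wave]) auto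
  ultimately show ?case
    using Suc by (simp add: algebra_simps)
qed

text \<open>The two end terms of \<open>wave_geometric\<close> have frequencies \<open>K + 1\<close>
  and \<open>- K\<close>, which differ by \<open>L\<close>. They agree at \<open>2 * d / L\<close>,
  so the sum vanishes unless the ratio \<open>wave 1 y\<close> is 1, that is, unless
  \<open>L\<close> divides \<open>d\<close>.\<close>

lemma sum_wave:
  assumes "L = 2 * K + 1"
  shows "(\<Sum>k = - int K..int K. wave k (2 * of_int d / real L)) = (if int L dvd d then of_nat L else 0)"
proof (cases "int L dvd d")
  case True
  then obtain c where c: "d = int L * c" by blast
  have "wave k (2 * of_int d / real L) = 1" for k
    using wave_period[of k c] assms by (simp add: c)
  then show ?thesis
    using True assms by simp
next
  case False
  define y where "y = 2 * real_of_int d / real L"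
  have L: "real L > 0" using assms by simp
  have "wave 1 y \<noteq> 1"
  proof
    assume "wave 1 y = 1"
    then have "exp (\<i> * complex_of_real (pi * y)) = 1"
      by (simp add: wave_def cis_conv_exp)
    then obtain n :: int where "pi * y = of_int (2 * n) * pi"
      by (auto simp: exp_eq_1)
    then have "y = 2 * of_int n" by simp
    then have "real_of_int d = of_int (int L * n)"
      using L by (simp add: y_def field_simps)
    then have "d = int L * n"
      using of_int_eq_iff by blast
    then show False using False by simp
  qed
  moreover have "wave (int K + 1) y = wave (- int K) y"
  proof -
    have "wave (int K + 1) y = wave (- int K) y * wave (int L) y"
      using assms by (simp flip: wave_freq_add)
    moreover have "wave (int L) y = wave 1 (2 * of_int d)"
      using L by (simp add: wave_def y_def)
    ultimately show ?thesis by (simp add: wave_period)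
  qed
  ultimately show ?thesis
    using wave_geometric[of y K] False by (simp add: y_def)
qed

lemma sum_wave_grid:
  assumes "L = 2 * K + 1" "i < L" "j < L"
  shows "(\<Sum>k = - int K..int K. wave (- k) (grid L i) * wave k (grid L j)) = (if i = j then of_nat L else 0)"
proof -
  have "wave (- k) (grid L i) * wave k (grid L j) = wave k (2 * of_int (int j - int i) / real L)" for k
    by (simp add: wave_def grid_def cis_mult algebra_simps diff_divide_distrib)
  moreover have "int L dvd int j - int i \<longleftrightarrow> i = j"
    using assms(2,3) dvd_imp_le_int[of "int j - int i" "int L"] by force
  ultimately show ?thesis
    using sum_wave[OF assms(1), of "int j - int i"] by simp
qed

lemma sum_plane_wave_grid:
  assumes "L = 2 * K + 1" "i < L" "j < L" "i' < L" "j' < L"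
  shows "(\<Sum>k\<in>freq_box K. (wave (- fst k) (grid L i) * wave (- snd k) (grid L j)) *
            plane_wave k (grid L i', grid L j')) = (if i = i' \<and> j = j' then (of_nat L)\<^sup>2 else 0)"
proof -
  have "(\<Sum>k\<in>freq_box K. (wave (- fst k) (grid L i) * wave (- snd k) (grid L j)) *
            plane_wave k (grid L i', grid L j'))
     = (\<Sum>k\<in>{- int K..int K}. \<Sum>l\<in>{- int K..int K}. (wave (- k) (grid L i) * wave k (grid L i'))
           * (wave (- l) (grid L j) * wave l (grid L j')))"
    unfolding freq_box_def sum.cartesian_product by (simp add: plane_wave_def case_prod_beta mult_ac)
  also have "\<dots> = (if i = i' then of_nat L else 0) * (if j = j' then of_nat L else 0)"
    unfolding sum_product[symmetric] sum_wave_grid[OF assms(1,2,4)] sum_wave_grid[OF assms(1,3,5)] ..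
  finally show ?thesis by (simp add: power2_eq_square)
qed

lemma fin_fourier_grid:
  assumes "L > 0"
  shows "fin_fourier f k L = of_real ((2 / real L)\<^sup>2) *
    (\<Sum>x\<in>{..<L} \<times> {..<L}. f (grid L (fst x), grid L (snd x)) *
       (wave (- fst k) (grid L (fst x)) * wave (- snd k) (grid L (snd x))))"
proof -
  have g: "- 1 + (real (Suc i) - 1) * (2 / real L) = grid L i" for i
    by (simp add: grid_def)
  have e: "exp (- complex_of_real pi * \<i> * (of_int k1 * of_real x + of_int k2 * of_real y))
      = wave (- k1) x * wave (- k2) y" for k1 k2 x y
    by (simp add: wave_def cis_conv_exp algebra_simps flip: exp_add)
  show ?thesis
    unfolding fin_fourier_def Let_def One_nat_def sum.atLeast1_atMost_eq g e
    unfolding sum.atLeast1_atMost_eq g sum.cartesian_product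
    by (simp add: case_prod_beta)
qed

text \<open>\<open>fin_fourier\<close> is a Riemann sum over the square of area 4; dividing by 4
  turns it into a Fourier coefficient.\<close>

definition interp :: "nat \<Rightarrow> (real \<times> real \<Rightarrow> complex) \<Rightarrow> real \<times> real \<Rightarrow> complex" where
  "interp K f p = (\<Sum>k\<in>freq_box K. fin_fourier f k (2 * K + 1) * plane_wave k p) / 4"

text \<open>Exchanging the sums over frequencies and nodes, orthogonality leaves a single node, and
  the weight \<open>(2 / L)\<^sup>2 * L\<^sup>2 = 4\<close> cancels the normalisation.\<close>

lemma interp_grid:
  assumes L: "L = 2 * K + 1" and ij: "i < L" "j < L"
  shows "interp K f (grid L i, grid L j) = f (grid L i, grid L j)"
proof -
  let ?I = "{..<L} \<times> {..<L}"
  have "L > 0" using L by simp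
  have "(\<Sum>k\<in>freq_box K. fin_fourier f k L * plane_wave k (grid L i, grid L j))
     = (\<Sum>k\<in>freq_box K. \<Sum>x\<in>?I. of_real ((2 / real L)\<^sup>2) * f (grid L (fst x), grid L (snd x)) *
        ((wave (- fst k) (grid L (fst x)) * wave (- snd k) (grid L (snd x))) * plane_wave k (grid L i, grid L j)))"
    by (simp only: fin_fourier_grid[OF \<open>L > 0\<close>] sum_distrib_left sum_distrib_right mult.assoc)
  also have "\<dots> = (\<Sum>x\<in>?I. \<Sum>k\<in>freq_box K. of_real ((2 / real L)\<^sup>2) * f (grid L (fst x), grid L (snd x)) *
        ((wave (- fst k) (grid L (fst x)) * wave (- snd k) (grid L (snd x))) * plane_wave k (grid L i, grid L j)))"
    by (rule sum.swap)
  also have "\<dots> = (\<Sum>x\<in>?I. if x = (i, j) then of_real ((2 / real L)\<^sup>2) * f (grid L i, grid L j) * (of_nat L)\<^sup>2 else 0)"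
  proof (rule sum.cong[OF refl])
    fix x assume "x \<in> ?I"
    then show "(\<Sum>k\<in>freq_box K. of_real ((2 / real L)\<^sup>2) * f (grid L (fst x), grid L (snd x)) *
        ((wave (- fst k) (grid L (fst x)) * wave (- snd k) (grid L (snd x))) * plane_wave k (grid L i, grid L j)))
      = (if x = (i, j) then of_real ((2 / real L)\<^sup>2) * f (grid L i, grid L j) * (of_nat L)\<^sup>2 else 0)"
      using sum_plane_wave_grid[OF L, of "fst x" "snd x" i j] ij
      unfolding sum_distrib_left[symmetric] by (cases x) auto
  qed
  also have "\<dots> = of_real ((2 / real L)\<^sup>2) * f (grid L i, grid L j) * (of_nat L)\<^sup>2"
    using ij by simp
  also have "\<dots> = 4 * f (grid L i, grid L j)"
  proof -
    have "(2 / real L)\<^sup>2 * (real L)\<^sup>2 = 4"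
      using \<open>L > 0\<close> by (simp add: power_divide)
    then have "complex_of_real ((2 / real L)\<^sup>2) * (of_nat L)\<^sup>2 = 4"
      by (metis of_real_mult of_real_numeral of_real_of_nat_eq of_real_power)
    then show ?thesis by simp
  qed
  finally show ?thesis
    using L by (simp add: interp_def)
qed

text \<open>The squared modulus is written as a product with the conjugate, and conjugating the
  waves gives \<open>plane_wave\<close> values. Once the frequency sum is innermost, orthogonality
  removes the off-diagonal pairs of nodes.\<close>

lemma discrete_parseval:
  fixes a :: "nat \<times> nat \<Rightarrow> complex"
  assumes L: "L = 2 * K + 1"
  shows "(\<Sum>k\<in>freq_box K. (norm (\<Sum>x\<in>{..<L} \<times> {..<L}. a x * (wave (- fst k) (grid L (fst x)) * wave (- snd k) (grid L (snd x)))))\<^sup>2)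
     = (real L)\<^sup>2 * (\<Sum>x\<in>{..<L} \<times> {..<L}. (norm (a x))\<^sup>2)"
proof -
  let ?I = "{..<L} \<times> {..<L}"
  let ?w = "\<lambda>k x. wave (- fst k) (grid L (fst x)) * wave (- snd k) (grid L (snd x))"
  let ?v = "\<lambda>k x. plane_wave k (grid L (fst x), grid L (snd x))"
  have "complex_of_real (\<Sum>k\<in>freq_box K. (norm (\<Sum>x\<in>?I. a x * ?w k x))\<^sup>2)
    = (\<Sum>k\<in>freq_box K. (\<Sum>x\<in>?I. a x * ?w k x) * cnj (\<Sum>x\<in>?I. a x * ?w k x))"
    by (simp only: of_real_sum complex_norm_square)
  also have "\<dots> = (\<Sum>k\<in>freq_box K. (\<Sum>x\<in>?I. a x * ?w k x) * (\<Sum>x\<in>?I. cnj (a x) * ?v k x))"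
    by (simp add: cnj_wave plane_wave_def)
  also have "\<dots> = (\<Sum>k\<in>freq_box K. \<Sum>x\<in>?I. \<Sum>y\<in>?I. (a x * cnj (a y)) * (?w k x * ?v k y))"
    unfolding sum_product by (simp add: mult_ac)
  also have "\<dots> = (\<Sum>x\<in>?I. \<Sum>k\<in>freq_box K. \<Sum>y\<in>?I. (a x * cnj (a y)) * (?w k x * ?v k y))"
    by (rule sum.swap)
  also have "\<dots> = (\<Sum>x\<in>?I. \<Sum>y\<in>?I. \<Sum>k\<in>freq_box K. (a x * cnj (a y)) * (?w k x * ?v k y))"
    by (intro sum.cong refl sum.swap)
  also have "\<dots> = (\<Sum>x\<in>?I. \<Sum>y\<in>?I. (a x * cnj (a y)) * (\<Sum>k\<in>freq_box K. ?w k x * ?v k y))"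
    by (simp add: sum_distrib_left)
  also have "\<dots> = (\<Sum>x\<in>?I. \<Sum>y\<in>?I. if y = x then (a x * cnj (a x)) * (of_nat L)\<^sup>2 else 0)"
  proof (intro sum.cong refl)
    fix x y assume "x \<in> ?I" "y \<in> ?I"
    then show "(a x * cnj (a y)) * (\<Sum>k\<in>freq_box K. ?w k x * ?v k y)
       = (if y = x then (a x * cnj (a x)) * (of_nat L)\<^sup>2 else 0)"
      using sum_plane_wave_grid[OF L, of "fst x" "snd x" "fst y" "snd y"]
      by (cases x; cases y) auto
  qed
  also have "\<dots> = (\<Sum>x\<in>?I. (a x * cnj (a x)) * (of_nat L)\<^sup>2)"
    by (intro sum.cong refl) (simp only: sum.delta finite_cartesian_product finite_lessThan if_True)
  also have "\<dots> = complex_of_real ((real L)\<^sup>2 * (\<Sum>x\<in>?I. (norm (a x))\<^sup>2))"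
    by (simp add: sum_distrib_left mult_ac flip: complex_norm_square)
  finally show ?thesis
    by (simp only: of_real_eq_iff)
qed

section \<open>Second differences and decay of the discrete Fourier coefficients\<close>

text \<open>Sine is concave on this interval, so it lies above its chord.\<close>

lemma jordan_sin_ge:
  fixes x :: real
  assumes "0 \<le> x" "x \<le> pi / 2"
  shows "sin x \<ge> 2 * x / pi"
proof -
  have "convex_on {0..pi/2} (\<lambda>x. - sin x :: real)"
    by (rule f''_ge0_imp_convex[where f' = "\<lambda>x. - cos x" and f'' = sin])
       (auto intro!: derivative_eq_intros sin_ge_zero)
  from convex_onD_Icc[OF this, of "2 * x / pi"] assms show ?thesis
    by (simp add: divide_simps)
qed

text \<open>The left-hand side is 4 sin(t)^2 with t = pi |k| / L. Since |k| <= K < L / 2, t lies in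
  the range of \<open>jordan_sin_ge\<close>, which gives sin t >= 2 |k| / L.\<close>

lemma cos_gap:
  assumes "L = 2 * K + 1" "\<bar>k\<bar> \<le> int K"
  shows "2 - 2 * cos (2 * pi * of_int k / real L) \<ge> 16 * (of_int k)\<^sup>2 / (real L)\<^sup>2"
proof -
  have L: "real L > 0" using assms by simp
  define t where "t = pi * \<bar>of_int k\<bar> / real L"
  have "real_of_int \<bar>k\<bar> \<le> real_of_int (int K)"
    using assms(2) by (rule of_int_le_iff[THEN iffD2])
  then have "2 * \<bar>real_of_int k\<bar> \<le> real L" using assms(1) by simp
  then have "pi * (2 * \<bar>of_int k\<bar>) \<le> pi * real L"
    by (intro mult_left_mono) auto
  then have t: "0 \<le> t" "t \<le> pi / 2"
    using L by (auto simp: t_def field_simps)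
  have "2 * \<bar>of_int k\<bar> / real L = 2 * t / pi"
    by (simp add: t_def)
  also have "\<dots> \<le> sin t" using jordan_sin_ge[OF t] .
  finally have "(2 * \<bar>of_int k\<bar> / real L)\<^sup>2 \<le> (sin t)\<^sup>2"
    by (rule power_mono) simp
  moreover have "cos (2 * pi * of_int k / real L) = cos (2 * t)"
  proof -
    have "2 * t = \<bar>2 * pi * of_int k / real L\<bar>"
      by (simp add: t_def abs_mult)
    then show ?thesis by (simp only: cos_abs_real)
  qed
  moreover have "cos (2 * t) = 1 - 2 * (sin t)\<^sup>2"
    by (rule cos_double_sin)
  ultimately show ?thesis
    by (simp add: power_divide power_mult_distrib)
qed

text \<open>The difference is cyclic, so that the discrete Fourier transform diagonalises it.\<close>

definition second_diff :: "nat \<Rightarrow> (nat \<Rightarrow> complex) \<Rightarrow> nat \<Rightarrow> complex" where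
  "second_diff L a i = a (Suc i) - 2 * a i + a (if i = 0 then L - 1 else i - 1)"

text \<open>Shifting the index forward or backward multiplies the transform by \<open>cnj q\<close>
  or \<open>q\<close>, and \<open>q + cnj q\<close> is twice the cosine. The wave has period
  \<open>L\<close> in the index, and \<open>a 0 = a L = 0\<close> makes the forward shift cyclic as
  well.\<close>

lemma sum_second_diff:
  assumes L: "L > 0" and a: "a 0 = 0" "a L = 0"
  shows "(\<Sum>i<L. second_diff L a i * wave (- k) (grid L i))
     = - of_real (2 - 2 * cos (2 * pi * of_int k / real L)) * (\<Sum>i<L. a i * wave (- k) (grid L i))"
proof -
  define w where "w i = wave (- k) (grid L i)" for i
  define q where "q = wave (- k) (2 / real L)"
  obtain n where n: "L = Suc n" using L gr0_implies_Suc by blast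
  have "grid L (Suc i) = grid L i + 2 / real L" for i
    by (simp add: grid_def add_divide_distrib algebra_simps)
  then have w_Suc: "w (Suc i) = w i * q" for i
    by (simp add: w_def q_def wave_add)
  have "q * cnj q = 1"
    by (simp add: q_def flip: complex_norm_square)
  then have w_back: "w i = w (Suc i) * cnj q" for i
    by (simp add: w_Suc mult.assoc)
  have q_sum: "q + cnj q = of_real (2 * cos (2 * pi * of_int k / real L))"
    by (simp add: q_def wave_def complex_eq_iff mult_ac)
  have "grid L L = grid L 0 + 2 * of_int 1"
    using L by (simp add: grid_def)
  then have w_L: "w L = w 0"
    unfolding w_def by (metis wave_add wave_period mult.right_neutral)
  have "(\<Sum>i<L. a (Suc i) * w (Suc i)) = (\<Sum>i<L. a i * w i)"
    using sum.lessThan_Suc_shift[of "\<lambda>i. a i * w i" L] a by simp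
  then have fwd: "(\<Sum>i<L. a (Suc i) * w i) = cnj q * (\<Sum>i<L. a i * w i)"
    by (subst w_back) (simp add: mult_ac flip: sum_distrib_left)
  have "(\<Sum>i<L. a (if i = 0 then L - 1 else i - 1) * w i) = (\<Sum>i<L. a i * w (Suc i))"
    using w_L unfolding n sum.lessThan_Suc[of "\<lambda>i. a i * w (Suc i)"] sum.lessThan_Suc_shift by simp
  then have bwd: "(\<Sum>i<L. a (if i = 0 then L - 1 else i - 1) * w i) = q * (\<Sum>i<L. a i * w i)"
    by (simp add: w_Suc mult_ac flip: sum_distrib_left)
  have "(\<Sum>i<L. second_diff L a i * w i)
      = (\<Sum>i<L. a (Suc i) * w i) - 2 * (\<Sum>i<L. a i * w i)
        + (\<Sum>i<L. a (if i = 0 then L - 1 else i - 1) * w i)"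
    unfolding second_diff_def
    by (simp add: algebra_simps sum.distrib sum_subtractf sum_distrib_left del: mult_Suc_right)
  also have "\<dots> = ((q + cnj q) - 2) * (\<Sum>i<L. a i * w i)"
    unfolding fwd bwd by (simp add: algebra_simps)
  finally show ?thesis
    unfolding q_sum w_def by (simp add: algebra_simps)
qed

text \<open>Second-order smoothness is expressed through differences along the axes, which apply
  directly to grid values. The constant is explicit because one and the same \<open>C\<close> has to
  serve a function and all its rotations.\<close>

definition smooth_bump :: "real \<Rightarrow> (real \<times> real \<Rightarrow> complex) \<Rightarrow> bool" where
  "smooth_bump C f \<longleftrightarrow> continuous_on UNIV f \<and> (\<forall>p. norm p \<ge> 1 \<longrightarrow> f p = 0) \<and>
     (\<forall>x y h. \<bar>x\<bar> \<le> 1 \<longrightarrow> \<bar>y\<bar> \<le> 1 \<longrightarrow> 0 \<le> h \<longrightarrow> h \<le> 1 \<longrightarrow>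
        norm (f (x + h, y) - 2 * f (x, y) + f (x - h, y)) \<le> C * h\<^sup>2 \<and>
        norm (f (x, y + h) - 2 * f (x, y) + f (x, y - h)) \<le> C * h\<^sup>2)"

lemma smooth_bump_swap: "smooth_bump C f \<Longrightarrow> smooth_bump C (f \<circ> prod.swap)"
  unfolding smooth_bump_def
  by (auto intro!: continuous_on_compose2[of UNIV f] continuous_on_swap simp: norm_Pair add.commute)

lemma smooth_bump_zero:
  assumes "smooth_bump C f" "\<bar>x\<bar> \<ge> 1 \<or> \<bar>y\<bar> \<ge> 1"
  shows "f (x, y) = 0"
proof -
  have "norm (x, y) \<ge> \<bar>x\<bar>" "norm (x, y) \<ge> \<bar>y\<bar>"
    using norm_fst_le[of x y] norm_snd_le[of y x] by auto
  then show ?thesis using assms by (force simp: smooth_bump_def)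
qed

lemma grid_bounds: "i \<le> L \<Longrightarrow> \<bar>grid L i\<bar> \<le> 1"
  by (cases "L = 0") (auto simp: grid_def abs_le_iff field_simps)

lemma second_diff_bound:
  assumes f: "smooth_bump C f" and L: "L \<ge> 2" and i: "i < L" and y: "\<bar>y\<bar> \<le> 1"
  shows "norm (second_diff L (\<lambda>i. f (grid L i, y)) i) \<le> 2 * C * (2 / real L)\<^sup>2"
proof -
  define h where "h = 2 / real L"
  have h: "0 \<le> h" "h \<le> 1" using L by (auto simp: h_def)
  have D: "norm (f (x + h, y) - 2 * f (x, y) + f (x - h, y)) \<le> C * h\<^sup>2" if "\<bar>x\<bar> \<le> 1" for x
    using f y h that by (auto simp: smooth_bump_def)
  have "0 \<le> C * h\<^sup>2" using D[of 0] by (rule order_trans[OF norm_ge_zero]) simp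
  have g_Suc: "grid L (Suc i) = grid L i + h" for i
    by (simp add: grid_def h_def add_divide_distrib)
  show ?thesis
  proof (cases i)
    case (Suc j)
    have "second_diff L (\<lambda>i. f (grid L i, y)) i
        = f (grid L i + h, y) - 2 * f (grid L i, y) + f (grid L i - h, y)"
      by (simp add: second_diff_def Suc g_Suc)
    then show ?thesis
      using D[of "grid L i"] grid_bounds[of i L] i \<open>0 \<le> C * h\<^sup>2\<close> by (simp add: h_def)
  next
    case 0
    have g: "grid L 0 = -1" "grid L (Suc 0) = -1 + h" "grid L (L - Suc 0) = 1 - h"
      using L by (auto simp: grid_def h_def field_simps of_nat_diff)
    \<comment> \<open>The values at -1 - h, -1, 1 and 1 + h are all zero, so the wrap-around
      difference splits into two ordinary ones, centred at -1 and at 1. This is where the factor 2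
      in the bound comes from.\<close>
    have "second_diff L (\<lambda>i. f (grid L i, y)) i
        = (f (-1 + h, y) - 2 * f (-1, y) + f (-1 - h, y)) + (f (1 + h, y) - 2 * f (1, y) + f (1 - h, y))"
      using h by (simp add: second_diff_def 0 g smooth_bump_zero[OF f])
    also have "norm \<dots> \<le> C * h\<^sup>2 + C * h\<^sup>2"
      by (intro norm_triangle_mono D) auto
    finally show ?thesis by (simp add: h_def)
  qed
qed

text \<open>A second difference in the first variable multiplies the transform by
  \<open>- \<rho> k\<close>, where \<open>\<rho> k\<close> is at least 16 k1^2 / L^2 by
  \<open>cos_gap\<close>. Parseval bounds the transform of the differences by L^2 terms of size at
  most (8 C / L^2)^2, and all powers of L cancel.\<close>

lemma fin_fourier_weighted_l2:
  assumes f: "smooth_bump C f" and K: "K \<ge> 1" and L: "L = 2 * K + 1"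
  shows "(\<Sum>k\<in>freq_box K. (of_int (fst k)) ^ 4 * (norm (fin_fourier f k L))\<^sup>2) \<le> 4 * C\<^sup>2"
proof -
  let ?I = "{..<L} \<times> {..<L}"
  have L2: "L \<ge> 2" "L > 0" "real L > 0" using K L by auto
  define b where "b x = second_diff L (\<lambda>i. f (grid L i, grid L (snd x))) (fst x)" for x :: "nat \<times> nat"
  let ?w = "\<lambda>k x. wave (- fst k) (grid L (fst x)) * wave (- snd k) (grid L (snd x))"
  define B where "B k = (\<Sum>x\<in>?I. b x * ?w k x)" for k
  define \<rho> where "\<rho> k = 2 - 2 * cos (2 * pi * of_int (fst k) / real L)" for k :: "int \<times> int"
  have B: "of_real ((2 / real L)\<^sup>2) * B k = - of_real (\<rho> k) * fin_fourier f k L" for k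
  proof -
    have "B k = (\<Sum>i<L. \<Sum>j<L. b (i, j) * ?w k (i, j))"
      by (simp add: B_def sum.cartesian_product case_prod_beta)
    \<comment> \<open>The differences act on the first index, so that sum is made the inner
      one.\<close>
    also have "\<dots> = (\<Sum>j<L. \<Sum>i<L. b (i, j) * ?w k (i, j))"
      by (rule sum.swap)
    also have "\<dots> = (\<Sum>j<L. wave (- snd k) (grid L j) * (\<Sum>i<L. b (i, j) * wave (- fst k) (grid L i)))"
      by (simp add: sum_distrib_left mult_ac)
    also have "\<dots> = (\<Sum>j<L. wave (- snd k) (grid L j) * (- of_real (\<rho> k) *
         (\<Sum>i<L. f (grid L i, grid L j) * wave (- fst k) (grid L i))))"
    proof -
      have "(\<Sum>i<L. b (i, j) * wave (- fst k) (grid L i)) = - of_real (\<rho> k) *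
         (\<Sum>i<L. f (grid L i, grid L j) * wave (- fst k) (grid L i))" for j
        unfolding b_def \<rho>_def fst_conv snd_conv
        by (rule sum_second_diff[OF L2(2)]) (use L2 in \<open>auto simp: grid_def smooth_bump_zero[OF f]\<close>)
      then show ?thesis by simp
    qed
    also have "\<dots> = - of_real (\<rho> k) * (\<Sum>j<L. \<Sum>i<L. f (grid L i, grid L j) * ?w k (i, j))"
      by (simp add: sum_distrib_left mult_ac sum_negf)
    also have "\<dots> = - of_real (\<rho> k) * (\<Sum>i<L. \<Sum>j<L. f (grid L i, grid L j) * ?w k (i, j))"
      by (subst sum.swap) simp
    finally show ?thesis
      by (simp add: fin_fourier_grid[OF L2(2)] sum.cartesian_product case_prod_beta)
  qed
  have "(16 / (real L)\<^sup>2)\<^sup>2 * ((of_int (fst k)) ^ 4 * (norm (fin_fourier f k L))\<^sup>2)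
      \<le> ((2 / real L)\<^sup>2)\<^sup>2 * (norm (B k))\<^sup>2" if "k \<in> freq_box K" for k
  proof -
    have "16 * (of_int (fst k))\<^sup>2 / (real L)\<^sup>2 \<le> \<rho> k"
      unfolding \<rho>_def by (rule cos_gap[OF L]) (use that in \<open>auto simp: freq_box_def\<close>)
    then have "(16 * (of_int (fst k))\<^sup>2 / (real L)\<^sup>2)\<^sup>2 * (norm (fin_fourier f k L))\<^sup>2
       \<le> (\<rho> k)\<^sup>2 * (norm (fin_fourier f k L))\<^sup>2"
      by (intro mult_right_mono power_mono) auto
    also have "\<dots> = (norm (of_real ((2 / real L)\<^sup>2) * B k))\<^sup>2"
      unfolding B by (simp add: norm_mult power_mult_distrib)
    also have "\<dots> = ((2 / real L)\<^sup>2)\<^sup>2 * (norm (B k))\<^sup>2"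
      by (simp add: norm_mult norm_power norm_divide power_mult_distrib)
    finally show ?thesis
      by (simp add: power_mult_distrib power_divide mult_ac)
  qed
  then have "(16 / (real L)\<^sup>2)\<^sup>2 * (\<Sum>k\<in>freq_box K. (of_int (fst k)) ^ 4 * (norm (fin_fourier f k L))\<^sup>2)
      \<le> ((2 / real L)\<^sup>2)\<^sup>2 * (\<Sum>k\<in>freq_box K. (norm (B k))\<^sup>2)"
    unfolding sum_distrib_left by (rule sum_mono)
  also have "(\<Sum>k\<in>freq_box K. (norm (B k))\<^sup>2) = (real L)\<^sup>2 * (\<Sum>x\<in>?I. (norm (b x))\<^sup>2)"
    unfolding B_def by (rule discrete_parseval[OF L])
  also have "((2 / real L)\<^sup>2)\<^sup>2 * \<dots> \<le> ((2 / real L)\<^sup>2)\<^sup>2 * ((real L)\<^sup>2 * (\<Sum>x\<in>?I. (2 * C * (2 / real L)\<^sup>2)\<^sup>2))"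
    unfolding b_def
    by (intro mult_left_mono sum_mono power_mono second_diff_bound[OF f L2(1)] grid_bounds) auto
  also have "\<dots> = (16 / (real L)\<^sup>2)\<^sup>2 * (4 * C\<^sup>2)"
    using L2(3) unfolding sum_constant card_cartesian_product card_lessThan power_divide of_nat_mult
    by (simp add: power2_eq_square field_simps)
  finally show ?thesis
    by (rule mult_left_le_imp_le) (use L2 in simp)
qed

section \<open>Aliasing between the grids of size L and 3 L\<close>

text \<open>\<open>wave (- (int L * a)) 1\<close> is the sign \<open>(-1)\<^sup>a\<close>; it appears because the grids start at \<open>-1\<close>.\<close>

definition alias_sign :: "nat \<Rightarrow> int \<times> int \<Rightarrow> complex" where
  "alias_sign L a = wave (- (int L * fst a)) 1 * wave (- (int L * snd a)) 1"

definition shift_freq :: "nat \<Rightarrow> int \<times> int \<Rightarrow> int \<times> int \<Rightarrow> int \<times> int" where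
  "shift_freq L k a = (fst k + int L * fst a, snd k + int L * snd a)"

lemma sum_freq_box: "(\<Sum>k\<in>freq_box K. g (fst k) * h (snd k)) =
    (\<Sum>k = - int K..int K. g k) * (\<Sum>k = - int K..int K. h k :: complex)"
  unfolding freq_box_def sum_product sum.cartesian_product by (simp add: case_prod_beta)

text \<open>The extra phase of the shifted frequency at node \<open>i\<close> is a sign, due to the
  grid starting at -1, times a cube root of unity to the power \<open>a * i\<close>. The factor on
  the left removes the sign.\<close>

lemma alias_wave:
  assumes "L > 0"
  shows "wave (- (int L * a)) 1 * wave (- (k + int L * a)) (grid (3 * L) i)
     = wave (- k) (grid (3 * L) i) * wave a (2 * of_int (- int i) / real 3)"
  unfolding wave_def cis_mult
  by (rule arg_cong[where f = cis]) (use assms in \<open>simp add: grid_def field_simps\<close>)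

text \<open>Summing the cube roots of unity over \<open>a\<close> acts as a filter: it yields 9 at
  nodes with both indices divisible by 3 and 0 at all others. The surviving nodes form the coarse
  grid, and 9 is the ratio of the quadrature weights.\<close>

lemma fin_fourier_alias:
  assumes L: "L > 0"
  shows "fin_fourier f k L = (\<Sum>a\<in>freq_box 1. alias_sign L a * fin_fourier f (shift_freq L k a) (3 * L))"
proof -
  let ?I = "{..<3 * L} \<times> {..<3 * L}"
  have L3: "3 * L > 0" using L by simp
  define F where "F x = f (grid (3 * L) (fst x), grid (3 * L) (snd x))" for x
  define w where "w x = wave (- fst k) (grid (3 * L) (fst x)) * wave (- snd k) (grid (3 * L) (snd x))" for x
  define c where "c = complex_of_real ((2 / real (3 * L))\<^sup>2)"
  define d where "d i = (\<Sum>a = - int 1..int 1. wave a (2 * of_int (- int i) / real 3))" for i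
  have d: "d i = (if 3 dvd i then 3 else 0)" for i
    using sum_wave[of 3 1 "- int i"] int_dvd_int_iff[of 3 i] by (simp add: d_def)
  have "(\<Sum>a\<in>freq_box 1. alias_sign L a * fin_fourier f (shift_freq L k a) (3 * L))
    = (\<Sum>a\<in>freq_box 1. \<Sum>x\<in>?I. c * F x * ((wave (- (int L * fst a)) 1 * wave (- (fst k + int L * fst a)) (grid (3 * L) (fst x)))
       * (wave (- (int L * snd a)) 1 * wave (- (snd k + int L * snd a)) (grid (3 * L) (snd x)))))"
    unfolding fin_fourier_grid[OF L3] alias_sign_def shift_freq_def sum_distrib_left F_def c_def fst_conv snd_conv
    by (simp only: mult_ac)
  also have "\<dots> = (\<Sum>x\<in>?I. \<Sum>a\<in>freq_box 1. (c * F x * w x) *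
       (wave (fst a) (2 * of_int (- int (fst x)) / real 3) * wave (snd a) (2 * of_int (- int (snd x)) / real 3)))"
    unfolding alias_wave[OF L] w_def by (subst sum.swap) (simp only: mult_ac)
  also have "\<dots> = (\<Sum>x\<in>?I. (c * F x * w x) * (d (fst x) * d (snd x)))"
    unfolding sum_distrib_left[symmetric] d_def
    by (intro sum.cong refl arg_cong2[where f = "(*)"] sum_freq_box)
  also have "\<dots> = (\<Sum>x\<in>(\<lambda>y. (3 * fst y, 3 * snd y)) ` ({..<L} \<times> {..<L}). (c * F x * w x) * (d (fst x) * d (snd x)))"
    by (rule sum.mono_neutral_right) (auto simp: d image_iff elim!: dvdE)
  also have "\<dots> = (\<Sum>y\<in>{..<L} \<times> {..<L}. (c * F (3 * fst y, 3 * snd y) * w (3 * fst y, 3 * snd y)) * 9)"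
    by (subst sum.reindex) (auto simp: inj_on_def d)
  also have "\<dots> = (c * 9) * (\<Sum>y\<in>{..<L} \<times> {..<L}. F (3 * fst y, 3 * snd y) * w (3 * fst y, 3 * snd y))"
    by (simp add: sum_distrib_left mult_ac)
  also have "\<dots> = fin_fourier f k L"
  proof -
    have g: "grid (3 * L) (3 * i) = grid L i" for i
      by (simp add: grid_def)
    have c9: "c * 9 = complex_of_real ((2 / real L)\<^sup>2)"
      by (simp add: c_def power_divide power_mult_distrib)
    show ?thesis
      unfolding c9 fin_fourier_grid[OF L] F_def w_def fst_conv snd_conv g ..
  qed
  finally show ?thesis ..
qed

text \<open>As 3 L = 2 (3 K + 1) + 1, the nine translates of the small box by multiples of
  \<open>L\<close> tile the large box. The function \<open>d\<close> recovers from a coordinate the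
  translate that contains it.\<close>

lemma sum_shift_freq:
  assumes L: "L = 2 * K + 1"
  shows "(\<Sum>k\<in>freq_box K. \<Sum>a\<in>freq_box 1. g (shift_freq L k a)) = (\<Sum>k\<in>freq_box (3 * K + 1). g k)"
proof -
  define d :: "int \<Rightarrow> int" where "d x = (if x > int K then 1 else if x < - int K then - 1 else 0)" for x
  have d1: "d (x + int L * a) = a" if "x \<in> {- int K..int K}" "a \<in> {-1..1}" for x a
  proof -
    have "a = -1 \<or> a = 0 \<or> a = 1" using that by auto
    then show ?thesis using that L by (auto simp: d_def)
  qed
  have d2: "x - int L * d x \<in> {- int K..int K}" "d x \<in> {-1..1}" if "x \<in> {- int (3*K+1)..int (3*K+1)}" for x
    using that L by (auto simp: d_def)
  have d3: "x + int L * a \<in> {- int (3*K+1)..int (3*K+1)}" if "x \<in> {- int K..int K}" "a \<in> {-1..1}" for x a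
  proof -
    have "a = -1 \<or> a = 0 \<or> a = 1" using that by auto
    then show ?thesis using that L by auto
  qed
  have "(\<Sum>ka\<in>freq_box K \<times> freq_box 1. g (shift_freq L (fst ka) (snd ka))) = (\<Sum>k\<in>freq_box (3 * K + 1). g k)"
    by (rule sum.reindex_bij_witness[where
          j = "\<lambda>ka. shift_freq L (fst ka) (snd ka)" and
          i = "\<lambda>k. ((fst k - int L * d (fst k), snd k - int L * d (snd k)), (d (fst k), d (snd k)))"])
      (use d1 d2 d3 in \<open>auto simp: freq_box_def shift_freq_def\<close>)
  then show ?thesis
    by (simp add: sum.cartesian_product case_prod_beta)
qed

text \<open>By aliasing, both interpolants become sums over the same fine coefficients. A
  coefficient inside the small box comes with the same wave in both and cancels; any other one is
  multiplied by a difference of two unimodular numbers, at most 2. The normalisation 1/4 turns this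
  2 into 1/2.\<close>

lemma interp_refine_diff:
  assumes L: "L = 2 * K + 1"
  shows "norm (interp (3 * K + 1) f p - interp K f p)
    \<le> (\<Sum>k\<in>freq_box (3 * K + 1) - freq_box K. norm (fin_fourier f k (3 * L))) / 2"
proof -
  have L0: "L > 0" using L by simp
  define c where "c k = fin_fourier f k (3 * L)" for k
  define h where "h k = (if k \<in> freq_box K then 0 else 2 * norm (c k))" for k
  have bound: "norm (c (shift_freq L k a) * (plane_wave (shift_freq L k a) p - alias_sign L a * plane_wave k p))
      \<le> h (shift_freq L k a)" if k: "k \<in> freq_box K" and a: "a \<in> freq_box 1" for k a
  proof (cases "shift_freq L k a \<in> freq_box K")
    case True
    have "x = 0" if "y \<in> {- int K..int K}" "y + int L * x \<in> {- int K..int K}" "x \<in> {-1..1}" for x y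
    proof -
      have "x = -1 \<or> x = 0 \<or> x = 1" using that by auto
      then show ?thesis using that L by auto
    qed
    then have "a = (0, 0)"
      using True k a by (cases a; cases k) (auto simp: freq_box_def shift_freq_def)
    then show ?thesis
      using k by (simp add: alias_sign_def shift_freq_def h_def)
  next
    case False
    have "norm (plane_wave (shift_freq L k a) p - alias_sign L a * plane_wave k p) \<le> 1 + 1"
      by (rule norm_triangle_le_diff) (simp add: alias_sign_def norm_mult)
    then show ?thesis
      using False mult_left_mono[of _ 2 "norm (c (shift_freq L k a))"]
      by (simp add: h_def norm_mult mult.commute[of 2])
  qed
  have L3: "2 * (3 * K + 1) + 1 = 3 * L" "2 * K + 1 = L" using L by auto
  have "4 * (interp (3 * K + 1) f p - interp K f p)
    = (\<Sum>k\<in>freq_box K. \<Sum>a\<in>freq_box 1. c (shift_freq L k a) * plane_wave (shift_freq L k a) p)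
     - (\<Sum>k\<in>freq_box K. fin_fourier f k L * plane_wave k p)"
    unfolding interp_def L3 sum_shift_freq[OF L, of "\<lambda>k. c k * plane_wave k p"] by (simp add: c_def)
  also have "\<dots> = (\<Sum>k\<in>freq_box K. \<Sum>a\<in>freq_box 1.
      c (shift_freq L k a) * (plane_wave (shift_freq L k a) p - alias_sign L a * plane_wave k p))"
    unfolding fin_fourier_alias[OF L0, of f] c_def
    by (simp add: sum_subtractf algebra_simps sum_distrib_left)
  also have "norm \<dots> \<le> (\<Sum>k\<in>freq_box K. \<Sum>a\<in>freq_box 1. h (shift_freq L k a))"
    by (intro order_trans[OF norm_sum] sum_mono bound)
  also have "\<dots> = (\<Sum>k\<in>freq_box (3 * K + 1). h k)"
    by (rule sum_shift_freq[OF L])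
  also have "\<dots> = (\<Sum>k\<in>freq_box (3 * K + 1) - freq_box K. 2 * norm (c k))"
    by (rule sum.mono_neutral_cong_right) (auto simp: h_def)
  finally have "4 * norm (interp (3 * K + 1) f p - interp K f p)
      \<le> 2 * (\<Sum>k\<in>freq_box (3 * K + 1) - freq_box K. norm (c k))"
    by (simp only: norm_mult norm_numeral sum_distrib_left[symmetric])
  then show ?thesis by (simp add: c_def)
qed

text \<open>Together with \<open>smooth_bump_swap\<close>, this carries the weighted bound from the
  first frequency coordinate to the second.\<close>

lemma fin_fourier_swap:
  assumes "L > 0"
  shows "fin_fourier (f \<circ> prod.swap) k L = fin_fourier f (prod.swap k) L"
proof -
  have "(\<Sum>x\<in>{..<L} \<times> {..<L}. g (prod.swap x)) = (\<Sum>x\<in>{..<L} \<times> {..<L}. g x)" for g :: "nat \<times> nat \<Rightarrow> complex"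
    by (rule sum.reindex_bij_witness[where i = prod.swap and j = prod.swap]) auto
  from this[of "\<lambda>x. f (grid L (fst x), grid L (snd x)) *
       (wave (- snd k) (grid L (fst x)) * wave (- fst k) (grid L (snd x)))"]
  show ?thesis
    by (simp add: fin_fourier_grid[OF assms] mult_ac)
qed

lemma smooth_bump_nonneg:
  assumes "smooth_bump C f" shows "C \<ge> 0"
proof -
  have "norm (f (0 + 1, 0) - 2 * f (0, 0) + f (0 - 1, 0)) \<le> C * 1\<^sup>2"
    using assms unfolding smooth_bump_def by (metis abs_zero order_refl zero_le_one)
  then show ?thesis using order_trans[OF norm_ge_zero] by fastforce
qed

text \<open>Outside the small box some coordinate is at least K + 1 > L / 2 in modulus, so the
  weighted bounds give a squared tail of at most 16 * 8 C^2 / L^4. The tail has at most 9 L^2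
  frequencies, and Cauchy-Schwarz yields a sum of order C / L.\<close>

lemma interp_refine:
  assumes f: "smooth_bump C f" and K: "K \<ge> 1" and L: "L = 2 * K + 1"
  shows "norm (interp (3 * K + 1) f p - interp K f p) \<le> 17 * C / real L"
proof -
  define K' where "K' = 3 * K + 1"
  have K': "K' \<ge> 1" "3 * L = 2 * K' + 1" using L by (auto simp: K'_def)
  have L0: "real L > 0" "L > 0" using L by auto
  define c where "c k = norm (fin_fourier f k (3 * L))" for k
  define D where "D = freq_box K' - freq_box K"
  have l2_fst: "(\<Sum>k\<in>freq_box K'. (of_int (fst k)) ^ 4 * (c k)\<^sup>2) \<le> 4 * C\<^sup>2"
    unfolding c_def by (rule fin_fourier_weighted_l2[OF f K'])
  have "(\<Sum>k\<in>freq_box K'. (of_int (fst k)) ^ 4 * (c (prod.swap k))\<^sup>2) \<le> 4 * C\<^sup>2"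
    using fin_fourier_weighted_l2[OF smooth_bump_swap[OF f] K'] L0
    by (simp add: c_def fin_fourier_swap)
  moreover have "(\<Sum>k\<in>freq_box K'. (of_int (fst k)) ^ 4 * (c (prod.swap k))\<^sup>2)
      = (\<Sum>k\<in>freq_box K'. (of_int (snd k)) ^ 4 * (c k)\<^sup>2)"
    by (rule sum.reindex_bij_witness[where i = prod.swap and j = prod.swap]) (auto simp: freq_box_def)
  ultimately have l2_snd: "(\<Sum>k\<in>freq_box K'. (of_int (snd k)) ^ 4 * (c k)\<^sup>2) \<le> 4 * C\<^sup>2"
    by simp
  have big: "(real L / 2) ^ 4 * (c k)\<^sup>2 \<le> (of_int (fst k)) ^ 4 * (c k)\<^sup>2 + (of_int (snd k)) ^ 4 * (c k)\<^sup>2"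
    if "k \<in> D" for k
  proof -
    have *: "(real L / 2) ^ 4 \<le> (real_of_int x) ^ 4" if "\<bar>x\<bar> > int K" for x
    proof -
      have "real_of_int (int K + 1) \<le> real_of_int \<bar>x\<bar>"
        using that by (intro of_int_le_iff[THEN iffD2]) simp
      then have "real L / 2 \<le> \<bar>real_of_int x\<bar>" using L by simp
      then have "(real L / 2) ^ 4 \<le> \<bar>real_of_int x\<bar> ^ 4" by (rule power_mono) simp
      then show ?thesis by simp
    qed
    have "\<bar>fst k\<bar> > int K \<or> \<bar>snd k\<bar> > int K"
      using that by (auto simp: D_def freq_box_def mem_Times_iff)
    then have "(real L / 2) ^ 4 \<le> (of_int (fst k)) ^ 4 + (of_int (snd k)) ^ 4"
      using *[of "fst k"] *[of "snd k"] by (smt (verit) zero_le_even_power'[of "of_int (fst k)" 2] zero_le_even_power'[of "of_int (snd k)" 2] mult_2 numeral_Bit0)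
    from mult_right_mono[OF this, of "(c k)\<^sup>2"] show ?thesis
      by (simp add: distrib_right)
  qed
  have "(real L / 2) ^ 4 * (\<Sum>k\<in>D. (c k)\<^sup>2)
      \<le> (\<Sum>k\<in>D. (of_int (fst k)) ^ 4 * (c k)\<^sup>2 + (of_int (snd k)) ^ 4 * (c k)\<^sup>2)"
    unfolding sum_distrib_left by (rule sum_mono[OF big])
  also have "\<dots> \<le> (\<Sum>k\<in>freq_box K'. (of_int (fst k)) ^ 4 * (c k)\<^sup>2 + (of_int (snd k)) ^ 4 * (c k)\<^sup>2)"
    by (rule sum_mono2) (auto simp: D_def)
  also have "\<dots> \<le> 8 * C\<^sup>2"
    using l2_fst l2_snd by (simp add: sum.distrib)
  finally have sq: "(\<Sum>k\<in>D. (c k)\<^sup>2) \<le> 128 * C\<^sup>2 / real L ^ 4"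
    using L0 by (simp add: power_divide field_simps)
  have "card D \<le> card (freq_box K')"
    by (intro card_mono) (auto simp: D_def)
  also have "\<dots> = (3 * L)\<^sup>2"
  proof -
    have "card {- int K'..int K'} = 3 * L" unfolding K'(2) by simp
    then show ?thesis
      unfolding freq_box_def card_cartesian_product by (simp add: power2_eq_square)
  qed
  finally have "real (card D) \<le> real ((3 * L)\<^sup>2)"
    by (rule of_nat_mono)
  then have card: "real (card D) \<le> 9 * (real L)\<^sup>2"
    by (simp add: power_mult_distrib)
  have "(\<Sum>k\<in>D. c k)\<^sup>2 \<le> (\<Sum>k\<in>D. (c k)\<^sup>2) * real (card D)"
    using Cauchy_Schwarz_ineq_sum[of c "\<lambda>_. 1" D] by simp
  also have "\<dots> \<le> (128 * C\<^sup>2 / real L ^ 4) * (9 * (real L)\<^sup>2)"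
    by (intro mult_mono sq card) auto
  also have "\<dots> = 1152 * (C\<^sup>2 / (real L)\<^sup>2)"
    using L0 by (simp add: power2_eq_square power4_eq_xxxx field_simps)
  \<comment> \<open>34^2 = 1156 is the first square above 1152; \<open>interp_refine_diff\<close>
    then halves 34 to 17.\<close>
  also have "\<dots> \<le> (34 * C / real L)\<^sup>2"
    by (simp add: power_divide power_mult_distrib divide_right_mono)
  finally have "(\<Sum>k\<in>D. c k) \<le> 34 * C / real L"
    by (rule power2_le_imp_le) (use smooth_bump_nonneg[OF f] in simp)
  then show ?thesis
    using interp_refine_diff[OF L, of f p] by (simp add: D_def c_def K'_def)
qed

section \<open>Nested grids and the uniform interpolation error\<close>

definition refine :: "nat \<Rightarrow> nat \<Rightarrow> nat" where
  "refine K j = ((\<lambda>n. 3 * n + 1) ^^ j) K"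

lemma refine_odd: "2 * refine K j + 1 = 3 ^ j * (2 * K + 1)"
  by (induction j) (auto simp: refine_def)

text \<open>Step \<open>j\<close> starts from grid size 3^j L and so costs 17 C / (3^j L). The
  factor 51/2 is 17 times the sum 3/2 of the geometric series with ratio 1/3.\<close>

lemma interp_refine_iterate:
  assumes f: "smooth_bump C f" and K: "K \<ge> 1" and L: "L = 2 * K + 1"
  shows "norm (interp (refine K j) f p - interp K f p) \<le> 51 / 2 * C / real L * (1 - 1 / 3 ^ j)"
proof (induction j)
  case 0
  then show ?case by (simp add: refine_def)
next
  case (Suc j)
  have "2 * refine K j + 1 \<ge> 3"
    unfolding refine_odd using mult_le_mono[of 1 "3 ^ j" 3 "2 * K + 1"] K by simp
  then have r: "refine K j \<ge> 1" by simp
  have "norm (interp (refine K (Suc j)) f p - interp (refine K j) f p) \<le> 17 * C / real (2 * refine K j + 1)"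
    using interp_refine[OF f r refl] by (simp add: refine_def)
  also have "\<dots> = 17 * C / real L / 3 ^ j"
  proof -
    have "real (2 * refine K j + 1) = 3 ^ j * real L" unfolding refine_odd L by (simp add: algebra_simps)
    then show ?thesis by (simp only: divide_divide_eq_left mult.commute)
  qed
  finally have "norm (interp (refine K (Suc j)) f p - interp K f p)
      \<le> 17 * C / real L / 3 ^ j + 51 / 2 * C / real L * (1 - 1 / 3 ^ j)"
    by (rule norm_diff_triangle_le[OF _ Suc])
  also have "\<dots> = 51 / 2 * C / real L * (1 - 1 / 3 ^ Suc j)"
  proof -
    have "17 * u * v + 51 / 2 * u * (1 - v) = 51 / 2 * u * (1 - v / 3)" for u v :: real
      by (simp add: algebra_simps diff_divide_distrib)
    from this[of "C / real L" "1 / 3 ^ j"] show ?thesis by (simp add: mult_ac)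
  qed
  finally show ?case .
qed

text \<open>The witness is the last node not to the right of \<open>x\<close>; \<open>x < 1\<close>
  keeps its index below \<open>L\<close>.\<close>

lemma grid_approx:
  assumes "L > 0" "\<bar>x\<bar> < 1"
  shows "\<exists>i<L. \<bar>grid L i - x\<bar> \<le> 2 / real L"
proof -
  define y where "y = (x + 1) * real L / 2"
  define i where "i = nat \<lfloor>y\<rfloor>"
  have L: "real L > 0" using assms by simp
  have y: "0 \<le> y" "y < real L"
    using assms L mult_strict_right_mono[of "x + 1" 2 "real L"] by (auto simp: y_def)
  have i: "real i \<le> y" "y < real i + 1"
    using y(1) by (auto simp: i_def)
  have "grid L i - x = 2 * (real i - y) / real L"
    using L by (simp add: grid_def y_def field_simps)
  then have "\<bar>grid L i - x\<bar> \<le> 2 / real L"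
    using i L by (simp add: abs_le_iff field_simps)
  moreover have "i < L" using i y by linarith
  ultimately show ?thesis by blast
qed

lemma continuous_on_plane_wave: "continuous_on A (plane_wave k)"
  unfolding plane_wave_def wave_def cis_conv_exp by (intro continuous_intros)

lemma continuous_on_interp: "continuous_on A (interp K f)"
  unfolding interp_def by (intro continuous_intros continuous_on_plane_wave) auto

text \<open>At a node of a refined grid \<open>f\<close> coincides with its refined interpolant, so
  there the error is at most the total cost \<open>B\<close> of all refinements. Refined nodes
  converge to any given point, and both \<open>f\<close> and the interpolant are continuous.\<close>

theorem interp_error:
  assumes f: "smooth_bump C f" and K: "K \<ge> 1" and p: "norm p \<le> 1"
  shows "norm (interp K f p - f p) \<le> 13 * C / real K"
proof -
  define L where "L = 2 * K + 1"
  define B where "B = 51 / 2 * C / real L"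
  have C: "C \<ge> 0" by (rule smooth_bump_nonneg[OF f])
  have cont: "continuous_on UNIV (\<lambda>p. norm (interp K f p - f p))"
    using f continuous_on_interp[of UNIV K f] by (auto simp: smooth_bump_def intro!: continuous_intros)
  have inner: "norm (interp K f p - f p) \<le> B" if p: "p \<in> ball 0 1" for p
  proof -
    have "\<bar>fst p\<bar> < 1" "\<bar>snd p\<bar> < 1"
      using p norm_fst_le[of "fst p" "snd p"] norm_snd_le[of "snd p" "fst p"] by auto
    moreover have "\<exists>i<3 ^ j * L. \<bar>grid (3 ^ j * L) i - x\<bar> \<le> 2 / real (3 ^ j * L)" if "\<bar>x\<bar> < 1" for j x
      by (rule grid_approx) (use that in \<open>simp_all add: L_def\<close>)
    ultimately have "\<exists>i<3 ^ j * L. \<bar>grid (3 ^ j * L) i - fst p\<bar> \<le> 2 / real (3 ^ j * L)"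
      "\<exists>i<3 ^ j * L. \<bar>grid (3 ^ j * L) i - snd p\<bar> \<le> 2 / real (3 ^ j * L)" for j
      by blast+
    then obtain i1 i2 where i: "\<And>j. i1 j < 3 ^ j * L" "\<And>j. i2 j < 3 ^ j * L"
      "\<And>j. \<bar>grid (3 ^ j * L) (i1 j) - fst p\<bar> \<le> 2 / real (3 ^ j * L)"
      "\<And>j. \<bar>grid (3 ^ j * L) (i2 j) - snd p\<bar> \<le> 2 / real (3 ^ j * L)"
      by metis
    define q where "q j = (grid (3 ^ j * L) (i1 j), grid (3 ^ j * L) (i2 j))" for j
    have "(\<lambda>j. 2 / real L * (1 / 3) ^ j) \<longlonglongrightarrow> 2 / real L * 0"
      by (intro tendsto_mult_left LIMSEQ_realpow_zero) auto
    then have lim0: "(\<lambda>j. 2 / real (3 ^ j * L)) \<longlonglongrightarrow> 0"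
      by (simp add: power_one_over field_simps)
    have "(\<lambda>j. grid (3 ^ j * L) (i1 j) - fst p) \<longlonglongrightarrow> 0" "(\<lambda>j. grid (3 ^ j * L) (i2 j) - snd p) \<longlonglongrightarrow> 0"
      by (rule Lim_null_comparison[OF _ lim0], use i in simp)+
    then have "q \<longlonglongrightarrow> (fst p, snd p)"
      unfolding q_def by (intro tendsto_Pair) (simp_all add: LIM_zero_iff)
    then have "q \<longlonglongrightarrow> p" by simp
    then have lim: "(\<lambda>j. norm (interp K f (q j) - f (q j))) \<longlonglongrightarrow> norm (interp K f p - f p)"
      using continuous_on_tendsto_compose[OF cont, of q p] by simp
    have "norm (interp K f (q j) - f (q j)) \<le> B" for j
    proof -
      have "f (q j) = interp (refine K j) f (q j)"
        unfolding q_def by (rule interp_grid[symmetric]) (use i refine_odd[of K j] in \<open>simp_all add: L_def\<close>)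
      then have "norm (interp K f (q j) - f (q j)) \<le> B * (1 - 1 / 3 ^ j)"
        using interp_refine_iterate[OF f K L_def, of j "q j"] by (simp add: B_def norm_minus_commute)
      also have "\<dots> \<le> B * 1"
        by (intro mult_left_mono) (use C in \<open>auto simp: B_def\<close>)
      finally show ?thesis by simp
    qed
    then show ?thesis
      by (intro LIMSEQ_le_const2[OF lim]) auto
  qed
  \<comment> \<open>Nodes approximate points of the open disk; its boundary is reached by taking the
    closure.\<close>
  have "closed {p. norm (interp K f p - f p) \<le> B}"
    using cont by (intro closed_Collect_le continuous_on_const)
  then have "closure (ball 0 1) \<subseteq> {p. norm (interp K f p - f p) \<le> B}"
    using inner by (intro closure_minimal) auto
  then have "norm (interp K f p - f p) \<le> B"
    using p by auto
  \<comment> \<open>Because 2 K + 1 > 2 K, it suffices that 51/4 <= 13.\<close>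
  also have "B \<le> 13 * C / real K"
    using C K unfolding B_def L_def by (simp add: field_simps mult_left_mono)
  finally show ?thesis .
qed

section \<open>Bessel functions\<close>

text \<open>This is the Bessel-Clifford function at \<open>- t\<close>: the entire factor of J_m
  that remains after dividing by (x / 2)^m, as a function of t = (x / 2)^2.\<close>

definition bessel_E :: "nat \<Rightarrow> real \<Rightarrow> real" where
  "bessel_E m t = (\<Sum>k. (-1) ^ k / (fact k * fact (k + m)) * t ^ k)"

definition besJ :: "nat \<Rightarrow> real \<Rightarrow> real" where
  "besJ m x = (x / 2) ^ m * bessel_E m ((x / 2)\<^sup>2)"

lemma summable_bessel_E: "summable (\<lambda>k. (-1) ^ k / (fact k * fact (k + m)) * (t::real) ^ k)"
proof (rule summable_comparison_test'[of "\<lambda>k. inverse (fact k) * \<bar>t\<bar> ^ k" 0])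
  show "summable (\<lambda>k. inverse (fact k) * \<bar>t\<bar> ^ k)"
    by (rule summable_exp)
  fix k
  have "1 * fact k \<le> (fact (k + m) * fact k :: real)"
    by (rule mult_right_mono) (auto simp: fact_ge_1)
  then have "1 / (fact k * fact (k + m)) \<le> (inverse (fact k) :: real)"
    by (simp add: field_simps)
  from mult_right_mono[OF this, of "\<bar>t\<bar> ^ k"]
  show "norm ((-1) ^ k / (fact k * fact (k + m)) * t ^ k) \<le> inverse (fact k) * \<bar>t\<bar> ^ k"
    by (simp add: abs_mult power_abs)
qed

lemma bessel_E_0: "bessel_E m 0 = 1 / fact m"
  using powser_zero[of "\<lambda>k. (-1) ^ k / (fact k * fact (k + m)) :: real"] by (simp add: bessel_E_def)

lemma DERIV_bessel_E: "(bessel_E m has_real_derivative - bessel_E (Suc m) t) (at t)"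
proof -
  let ?c = "\<lambda>k. (-1) ^ k / (fact k * fact (k + m)) :: real"
  have d: "diffs ?c k * t ^ k = - ((-1) ^ k / (fact k * fact (k + Suc m)) * t ^ k)" for k
    by (simp add: diffs_def divide_simps)
  have "((\<lambda>x. \<Sum>k. ?c k * x ^ k) has_real_derivative (\<Sum>k. diffs ?c k * t ^ k)) (at t)"
    by (rule termdiffs_strong_converges_everywhere) (rule summable_bessel_E)
  moreover have "(\<Sum>k. diffs ?c k * t ^ k) = - bessel_E (Suc m) t"
    unfolding d bessel_E_def by (rule suminf_minus[OF summable_bessel_E])
  ultimately show ?thesis
    unfolding bessel_E_def[abs_def] by simp
qed

text \<open>Coefficientwise, the order \<open>m\<close> term is k + m + 1 times the order
  \<open>m + 1\<close> term. Subtracting m + 1 of the latter leaves the factor k, and the series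
  with factor k, shifted by one index, is \<open>- t\<close> times the series of order
  \<open>m + 2\<close>.\<close>

lemma bessel_E_recurrence:
  "t * bessel_E (Suc (Suc m)) t - (real m + 1) * bessel_E (Suc m) t + bessel_E m t = 0"
proof -
  let ?a = "\<lambda>m k. (-1) ^ k / (fact k * fact (k + m)) * t ^ k"
  have s: "?a m sums bessel_E m t" for m
    unfolding bessel_E_def by (rule summable_sums[OF summable_bessel_E])
  have f: "fact (k + Suc m) = (real k + real m + 1) * (fact (k + m) :: real)" for k
    by simp
  have "(\<lambda>k. ?a m k - (real m + 1) * ?a (Suc m) k) sums (bessel_E m t - (real m + 1) * bessel_E (Suc m) t)"
    by (intro sums_diff sums_mult s)
  moreover have "?a m k - (real m + 1) * ?a (Suc m) k = real k * ?a (Suc m) k" for k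
  proof -
    define s where "s = real k + real m + 1"
    have "s \<noteq> 0" unfolding s_def by linarith
    then have "?a m k = s * ?a (Suc m) k"
      unfolding f s_def[symmetric] by (simp add: field_simps)
    then have "?a m k - (real m + 1) * ?a (Suc m) k = (s - (real m + 1)) * ?a (Suc m) k"
      by (simp only: left_diff_distrib)
    then show ?thesis by (simp only: s_def add_diff_cancel_right add.assoc add_diff_cancel_right')
  qed
  ultimately have "(\<lambda>k. real k * ?a (Suc m) k) sums (bessel_E m t - (real m + 1) * bessel_E (Suc m) t)"
    by simp
  then have "(\<lambda>k. real (Suc k) * ?a (Suc m) (Suc k)) sums (bessel_E m t - (real m + 1) * bessel_E (Suc m) t)"
    by (subst sums_Suc_iff) simp
  moreover have "real (Suc k) * ?a (Suc m) (Suc k) = - t * ?a (Suc (Suc m)) k" for k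
    by (simp add: field_simps del: of_nat_Suc)
  moreover have "(\<lambda>k. - t * ?a (Suc (Suc m)) k) sums (- t * bessel_E (Suc (Suc m)) t)"
    by (intro sums_mult s)
  ultimately have "bessel_E m t - (real m + 1) * bessel_E (Suc m) t = - t * bessel_E (Suc (Suc m)) t"
    using sums_unique2 by (metis (no_types, lifting) ext)
  then show ?thesis by simp
qed

lemma rGamma_of_nat_Suc: "rGamma (real n + 1) = 1 / fact n"
  using Gamma_fact[of n, where ?'a = real] by (simp add: rGamma_inverse_Gamma add.commute divide_inverse)

lemma bessel_J_of_nat: "bessel_J (int m) x = besJ m x"
proof -
  have "(x / 2) powi (2 * int k + int m) = (x / 2) ^ m * ((x / 2)\<^sup>2) ^ k" for k
  proof -
    have "2 * int k + int m = int (m + 2 * k)" by simp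
    then show ?thesis by (simp only: power_int_of_nat power_add power_mult)
  qed
  moreover have "rGamma (real k + of_int (int m) + 1) = 1 / fact (k + m)" for k
    using rGamma_of_nat_Suc[of "k + m"] by (simp add: add_ac)
  ultimately have "bessel_J (int m) x
      = (\<Sum>k. (x / 2) ^ m * ((-1) ^ k / (fact k * fact (k + m)) * ((x / 2)\<^sup>2) ^ k))"
    by (simp add: bessel_J_def mult_ac)
  also have "\<dots> = besJ m x"
    unfolding besJ_def bessel_E_def by (rule suminf_mult[OF summable_bessel_E])
  finally show ?thesis .
qed

text \<open>The poles of Gamma remove the terms with \<open>k < m\<close>; after a shift of the
  index by \<open>m\<close> the remaining series is that of J_m up to the sign.\<close>

lemma bessel_J_minus: "bessel_J (- int m) x = (-1) ^ m * besJ m x"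
proof -
  let ?g = "\<lambda>k. (-1) ^ k / fact k * rGamma (real k + of_int (- int m) + 1) * (x / 2) powi (2 * int k + - int m)"
  have zero: "?g k = 0" if "k < m" for k
  proof -
    have eq: "real k + of_int (- int m) + 1 = - of_nat (m - k - 1)"
      using that by (simp add: of_nat_diff)
    have "rGamma (real k + of_int (- int m) + 1) = 0"
      unfolding eq rGamma_eq_zero_iff by (rule minus_of_nat_in_nonpos_Ints)
    then show ?thesis by simp
  qed
  have shift: "?g (k + m) = (-1) ^ m * (x / 2) ^ m * ((-1) ^ k / (fact k * fact (k + m)) * ((x / 2)\<^sup>2) ^ k)" for k
  proof -
    have "2 * int (k + m) + - int m = int (m + 2 * k)" by simp
    moreover have "(x / 2) powi int (m + 2 * k) = (x / 2) ^ m * ((x / 2)\<^sup>2) ^ k"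
      by (simp only: power_int_of_nat power_add power_mult)
    moreover have "rGamma (real (k + m) + of_int (- int m) + 1) = 1 / fact k"
      using rGamma_of_nat_Suc[of k] by simp
    ultimately show ?thesis
      by (simp add: power_add mult_ac)
  qed
  have "(\<lambda>k. ?g (k + m)) sums ((-1) ^ m * (x / 2) ^ m * bessel_E m ((x / 2)\<^sup>2))"
    unfolding shift bessel_E_def by (intro sums_mult summable_sums[OF summable_bessel_E])
  then have "?g sums ((-1) ^ m * (x / 2) ^ m * bessel_E m ((x / 2)\<^sup>2) + (\<Sum>k<m. ?g k))"
    by (rule sums_iff_shift[of ?g m, THEN iffD1])
  moreover have "(\<Sum>k<m. ?g k) = 0"
    using zero by (intro sum.neutral) auto
  ultimately show ?thesis
    unfolding bessel_J_def besJ_def by (simp add: sums_iff mult_ac)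
qed

section \<open>Bessel's equation and Lommel's integrals\<close>

text \<open>\<open>besD m\<close> is the derivative of \<open>J\<^sub>m\<close>, \<open>besP m x\<close> equals \<open>x * besD m x\<close>, and \<open>besQ m\<close> is the derivative of
  \<open>besP m\<close>. Working with \<open>besP\<close> keeps all formulas free of division by \<open>x\<close>.\<close>

definition besD :: "nat \<Rightarrow> real \<Rightarrow> real" where
  "besD m x = real m / 2 * (x / 2) ^ (m - 1) * bessel_E m ((x / 2)\<^sup>2)
     - (x / 2) ^ (m + 1) * bessel_E (Suc m) ((x / 2)\<^sup>2)"

definition besP :: "nat \<Rightarrow> real \<Rightarrow> real" where
  "besP m x = real m * besJ m x - x * besJ (Suc m) x"

definition besQ :: "nat \<Rightarrow> real \<Rightarrow> real" where
  "besQ m x = real m * besD m x - besJ (Suc m) x - x * besD (Suc m) x"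

lemma DERIV_besJ: "(besJ m has_real_derivative besD m x) (at x)"
proof -
  have "((\<lambda>x. bessel_E m ((x / 2)\<^sup>2)) has_real_derivative - bessel_E (Suc m) ((x / 2)\<^sup>2) * (x / 2)) (at x)"
    by (rule DERIV_chain2[OF DERIV_bessel_E])
       (auto intro!: derivative_eq_intros simp: field_simps)
  moreover have "((\<lambda>x. (x / 2) ^ m) has_real_derivative real m * (x / 2) ^ (m - 1) * (1 / 2)) (at x)"
    by (auto intro!: derivative_eq_intros)
  ultimately show ?thesis
    unfolding besJ_def[abs_def] besD_def
    by (auto intro!: derivative_eq_intros simp: algebra_simps)
qed

text \<open>The case \<open>m = 0\<close> is separate because the exponent \<open>m - 1\<close> in
  \<open>besD\<close> is then truncated to 0; the factor \<open>real m\<close> removes that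
  term.\<close>

lemma besP_eq: "besP m x = x * besD m x"
  by (cases m) (simp_all add: besP_def besD_def besJ_def algebra_simps)

lemma DERIV_besP: "(besP m has_real_derivative besQ m x) (at x)"
  unfolding besP_def[abs_def] besQ_def
  by (auto intro!: derivative_eq_intros DERIV_besJ)

text \<open>Bessel's equation in the form x (x J')' = (m^2 - x^2) J. Eliminating derivatives leaves
  the orders m, m + 1 and m + 2, which the three-term recurrence combines.\<close>

lemma bessel_ode: "x * besQ m x = ((real m)\<^sup>2 - x\<^sup>2) * besJ m x"
proof -
  have "x * besQ m x = real m * besP m x - x * besJ (Suc m) x - x * besP (Suc m) x"
    by (simp add: besQ_def besP_eq algebra_simps)
  also have "\<dots> = (real m)\<^sup>2 * besJ m x - 2 * (real m + 1) * (x * besJ (Suc m) x) + x\<^sup>2 * besJ (Suc (Suc m)) x"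
    by (simp add: besP_def power2_eq_square algebra_simps)
  also have "\<dots> = (real m)\<^sup>2 * besJ m x + x\<^sup>2 * (x / 2) ^ m *
      ((x / 2)\<^sup>2 * bessel_E (Suc (Suc m)) ((x / 2)\<^sup>2) - (real m + 1) * bessel_E (Suc m) ((x / 2)\<^sup>2))"
    by (simp add: besJ_def power2_eq_square algebra_simps)
  also have "(x / 2)\<^sup>2 * bessel_E (Suc (Suc m)) ((x / 2)\<^sup>2) - (real m + 1) * bessel_E (Suc m) ((x / 2)\<^sup>2)
      = - bessel_E m ((x / 2)\<^sup>2)"
    using bessel_E_recurrence[of "(x / 2)\<^sup>2" m] by linarith
  finally show ?thesis
    by (simp add: besJ_def algebra_simps)
qed

lemmas DERIV_besJ' [derivative_intros] = DERIV_chain2[OF DERIV_besJ]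
lemmas DERIV_besP' [derivative_intros] = DERIV_chain2[OF DERIV_besP]

lemma continuous_on_besJ [continuous_intros]:
  "continuous_on A f \<Longrightarrow> continuous_on A (\<lambda>x. besJ m (f x))"
  by (rule continuous_on_compose2[of UNIV])
     (auto intro!: DERIV_continuous_on DERIV_besJ[THEN DERIV_subset])

lemma continuous_on_besP [continuous_intros]:
  "continuous_on A f \<Longrightarrow> continuous_on A (\<lambda>x. besP m (f x))"
  by (rule continuous_on_compose2[of UNIV])
     (auto intro!: DERIV_continuous_on DERIV_besP[THEN DERIV_subset])

lemma continuous_on_bessel_E [continuous_intros]:
  "continuous_on A f \<Longrightarrow> continuous_on A (\<lambda>x. bessel_E m (f x))"
  by (rule continuous_on_compose2[of UNIV])
     (auto intro!: DERIV_continuous_on DERIV_bessel_E[THEN DERIV_subset])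

lemma besJ_0: "besJ m 0 = (if m = 0 then 1 else 0)"
  by (simp add: besJ_def bessel_E_0)

text \<open>\<open>H\<close> is the Wronskian, weighted by r, of J_m(z r) and J_m(a r); Bessel's
  equation shows that its derivative is the integrand. The equation carries a factor r, so the
  derivative is computed for r > 0 only and continuity covers the end point 0.\<close>

lemma lommel:
  "((\<lambda>r. (a\<^sup>2 - z\<^sup>2) * (r * (besJ m (z * r) * besJ m (a * r)))) has_integral
      (besP m z * besJ m a - besJ m z * besP m a)) {0..1}"
proof -
  define H where "H r = besP m (z * r) * besJ m (a * r) - besJ m (z * r) * besP m (a * r)" for r
  have "((\<lambda>r. (a\<^sup>2 - z\<^sup>2) * (r * (besJ m (z * r) * besJ m (a * r)))) has_integral (H 1 - H 0)) {0..1}"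
  proof (rule fundamental_theorem_of_calculus_interior)
    show "continuous_on {0..1} H"
      unfolding H_def by (intro continuous_intros)
    fix r :: real assume "r \<in> {0<..<1}"
    then have r: "r \<noteq> 0" by auto
    have "(H has_real_derivative (besQ m (z * r) * z * besJ m (a * r) + besD m (a * r) * a * besP m (z * r)
        - (besD m (z * r) * z * besP m (a * r) + besQ m (a * r) * a * besJ m (z * r)))) (at r)"
      unfolding H_def by (auto intro!: derivative_eq_intros)
    moreover have "(besQ m (z * r) * z * besJ m (a * r) + besD m (a * r) * a * besP m (z * r)
        - (besD m (z * r) * z * besP m (a * r) + besQ m (a * r) * a * besJ m (z * r)))
       = (a\<^sup>2 - z\<^sup>2) * (r * (besJ m (z * r) * besJ m (a * r)))" (is "?L = ?R")
    proof -
      have "r * ?L = (z * r * besQ m (z * r)) * besJ m (a * r) - (a * r * besQ m (a * r)) * besJ m (z * r)"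
        by (simp add: besP_eq algebra_simps)
      also have "\<dots> = r * ?R"
        unfolding bessel_ode by (simp add: power2_eq_square algebra_simps)
      finally show ?thesis using r by simp
    qed
    ultimately show "(H has_vector_derivative (a\<^sup>2 - z\<^sup>2) * (r * (besJ m (z * r) * besJ m (a * r)))) (at r)"
      by (simp add: has_real_derivative_iff_has_vector_derivative)
  qed simp
  moreover have "H 0 = 0" "H 1 = besP m z * besJ m a - besJ m z * besP m a"
    by (simp_all add: H_def mult.commute)
  ultimately show ?thesis by simp
qed

text \<open>In the derivative of \<open>G\<close>, Bessel's equation multiplied by 2 J' cancels
  everything but the integrand. The formula serves both the confluent case a = z and the simplicity
  of zeros.\<close>

lemma lommel_diagonal:
  assumes "z \<ge> 0"
  shows "((\<lambda>x. 2 * x * (besJ m x)\<^sup>2) has_integral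
      ((besP m z)\<^sup>2 + (z\<^sup>2 - (real m)\<^sup>2) * (besJ m z)\<^sup>2)) {0..z}"
proof -
  define G where "G x = (besP m x)\<^sup>2 + (x\<^sup>2 - (real m)\<^sup>2) * (besJ m x)\<^sup>2" for x
  have "((\<lambda>x. 2 * x * (besJ m x)\<^sup>2) has_integral (G z - G 0)) {0..z}"
  proof (rule fundamental_theorem_of_calculus_interior)
    show "continuous_on {0..z} G"
      unfolding G_def by (intro continuous_intros)
    fix x assume "x \<in> {0<..<z}"
    have "(G has_real_derivative (2 * besP m x * besQ m x + (2 * x * (besJ m x)\<^sup>2
        + (x\<^sup>2 - (real m)\<^sup>2) * (2 * besJ m x * besD m x)))) (at x)"
      unfolding G_def by (auto intro!: derivative_eq_intros simp: algebra_simps)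
    moreover have "2 * besP m x * besQ m x = - ((x\<^sup>2 - (real m)\<^sup>2) * (2 * besJ m x * besD m x))"
    proof -
      have "2 * besP m x * besQ m x = 2 * besD m x * (x * besQ m x)"
        by (simp add: besP_eq)
      then show ?thesis unfolding bessel_ode by (simp add: algebra_simps)
    qed
    ultimately show "(G has_vector_derivative 2 * x * (besJ m x)\<^sup>2) (at x)"
      by (simp add: has_real_derivative_iff_has_vector_derivative)
  qed (use assms in simp)
  \<comment> \<open>\<open>besP\<close> carries a factor x, and either m = 0 or J_m(0) = 0.\<close>
  moreover have "G 0 = 0"
    by (simp add: G_def besP_eq besJ_0)
  ultimately show ?thesis by (simp add: G_def)
qed

section \<open>Positive zeros of Bessel functions\<close>

lemma besJ_nonzero_near_0: "\<exists>d>0. \<forall>x. \<bar>x\<bar> < d \<longrightarrow> besJ m x = 0 \<longrightarrow> x = 0"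
proof -
  have "isCont (\<lambda>x. bessel_E m ((x / 2)\<^sup>2)) 0"
    by (rule continuous_on_interior[of UNIV]) (auto intro!: continuous_intros)
  then have "eventually (\<lambda>x. bessel_E m ((x / 2)\<^sup>2) \<noteq> 0) (at 0)"
    unfolding isCont_def by (rule tendsto_imp_eventually_ne) (simp add: bessel_E_0)
  then obtain d where "d > 0" "\<And>x. x \<noteq> 0 \<Longrightarrow> \<bar>x\<bar> < d \<Longrightarrow> bessel_E m ((x / 2)\<^sup>2) \<noteq> 0"
    unfolding eventually_at by (auto simp: dist_real_def)
  then show ?thesis by (auto simp: besJ_def)
qed

text \<open>At a double zero the right-hand side of \<open>lommel_diagonal\<close> vanishes. Its
  integrand is continuous and nonnegative, so J_m would be zero on all of [0, z], contradicting its
  behaviour near 0.\<close>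

lemma besJ_simple_zero:
  assumes z: "z > 0" "besJ m z = 0"
  shows "besD m z \<noteq> 0"
proof
  assume "besD m z = 0"
  then have "((\<lambda>x. 2 * x * (besJ m x)\<^sup>2) has_integral 0) {0..z}"
    using lommel_diagonal[of z m] z by (simp add: besP_eq)
  then have int0: "((\<lambda>x. 2 * x * (besJ m x)\<^sup>2) has_integral 0) (cbox 0 z)"
    by simp
  have J0: "2 * x * (besJ m x)\<^sup>2 = 0" if "x \<in> cbox 0 z" for x
    by (rule has_integral_0_cbox_imp_0[OF _ _ int0 _ that])
       (use z in \<open>auto intro!: continuous_intros simp: box_ne_empty\<close>)
  obtain d where d: "d > 0" "\<And>x. \<bar>x\<bar> < d \<Longrightarrow> besJ m x = 0 \<Longrightarrow> x = 0"
    using besJ_nonzero_near_0 by blast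
  define w where "w = min (d / 2) z"
  have w: "0 < w" "w \<le> z" "w < d" using d(1) z by (auto simp: w_def)
  then have "besJ m w = 0" using J0[of w] by simp
  then show False using d(2)[of w] w by simp
qed

text \<open>Infinitely many zeros would accumulate at some point. This fails at a positive zero
  because zeros are simple, at 0 by \<open>besJ_nonzero_near_0\<close>, and elsewhere by
  continuity.\<close>

lemma finite_besJ_zeros: "finite {y. 0 < y \<and> y \<le> b \<and> besJ m y = 0}" (is "finite ?S")
proof (rule ccontr)
  assume "infinite ?S"
  moreover have "?S \<subseteq> {0..b}" by auto
  ultimately obtain \<xi> where \<xi>: "\<xi> \<in> {0..b}" "\<xi> islimpt ?S"
    using compact_Icc[of 0 b] unfolding compact_eq_Bolzano_Weierstrass by blast
  have "eventually (\<lambda>y. y \<notin> ?S) (at \<xi>)"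
  proof (cases "besJ m \<xi> = 0 \<and> \<xi> > 0")
    case True
    then have "besD m \<xi> \<noteq> 0" using besJ_simple_zero by blast
    moreover have "((\<lambda>y. (besJ m y - besJ m \<xi>) / (y - \<xi>)) \<longlongrightarrow> besD m \<xi>) (at \<xi>)"
      using DERIV_besJ[of m \<xi>] by (simp add: has_field_derivative_iff)
    ultimately have "eventually (\<lambda>y. (besJ m y - besJ m \<xi>) / (y - \<xi>) \<noteq> 0) (at \<xi>)"
      using tendsto_imp_eventually_ne by blast
    then show ?thesis
      by (rule eventually_mono) (use True in auto)
  next
    case False
    show ?thesis
    proof (cases "\<xi> = 0")
      case True
      obtain d where "d > 0" "\<And>x. \<bar>x\<bar> < d \<Longrightarrow> besJ m x = 0 \<Longrightarrow> x = 0"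
        using besJ_nonzero_near_0 by blast
      then show ?thesis
        unfolding eventually_at True by (auto simp: dist_real_def intro!: exI[of _ d])
    next
      case False
      then have "besJ m \<xi> \<noteq> 0" using \<open>\<not> (besJ m \<xi> = 0 \<and> \<xi> > 0)\<close> \<xi>(1) by auto
      moreover have "(besJ m \<longlongrightarrow> besJ m \<xi>) (at \<xi>)"
        using DERIV_isCont[OF DERIV_besJ] by (simp add: isCont_def)
      ultimately have "eventually (\<lambda>y. besJ m y \<noteq> 0) (at \<xi>)"
        using tendsto_imp_eventually_ne by blast
      then show ?thesis by (rule eventually_mono) auto
    qed
  qed
  then show False
    using \<xi>(2) by (simp add: islimpt_iff_eventually)
qed

text \<open>Sturm comparison of \<open>\<surd>x J\<^sub>m(x)\<close> with \<open>sin ((x - c) / 2)\<close>: \<open>W\<close> is their Wronskian.\<close>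

lemma besJ_zero_in_interval:
  assumes c: "c > 2 * real m"
  shows "\<exists>x. c \<le> x \<and> x \<le> c + 2 * pi \<and> besJ m x = 0"
proof (rule ccontr)
  assume no: "\<not> ?thesis"
  \<comment> \<open>The length 2 pi is the half-period of the comparison function, which is thus
    positive inside and zero at both ends.\<close>
  define b where "b = c + 2 * pi"
  have c0: "c > 0" "b > c" using c by (auto simp: b_def intro: le_less_trans[of 0 "2 * real m"])
  have ne: "besJ m x \<noteq> 0" if "x \<in> {c..b}" for x
    using no that by (auto simp: b_def)
  define s where "s = sgn (besJ m c)"
  have pos: "s * besJ m x > 0" if x: "x \<in> {c..b}" for x
  proof (rule ccontr)
    assume neg: "\<not> s * besJ m x > 0"
    have "continuous_on {c..x} (\<lambda>x. s * besJ m x)" by (intro continuous_intros)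
    moreover have "s * besJ m c \<ge> 0" by (simp add: s_def sgn_mult_self_eq[symmetric] abs_sgn[symmetric] sgn_if)
    ultimately obtain y where "c \<le> y" "y \<le> x" "s * besJ m y = 0"
      using IVT2'[of "\<lambda>x. s * besJ m x" x 0 c] neg x by auto
    then show False
      using ne[of y] ne[of c] x c0 by (auto simp: s_def sgn_if split: if_splits)
  qed
  define W where "W x = (besJ m x / 2 + besP m x) / sqrt x * sin ((x - c) / 2)
      - sqrt x * besJ m x * cos ((x - c) / 2) / 2" for x
  define W' where "W' x = besJ m x * ((real m)\<^sup>2 - 1 / 4 - 3 / 4 * x\<^sup>2) / (x * sqrt x) * sin ((x - c) / 2)" for x
  have DW: "(W has_real_derivative W' x) (at x)" if "c \<le> x" "x \<le> b" for x
  proof -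
    have x: "x > 0" using that c0 by simp
    define r where "r = sqrt x"
    have r: "r > 0" "x = r\<^sup>2" using x by (auto simp: r_def)
    have Q: "besQ m x = ((real m)\<^sup>2 - x\<^sup>2) * besJ m x / x"
      using bessel_ode[of x m] x by (simp add: field_simps)
    have sq: "sqrt x * (sqrt x * y) = x * y" for y
      using x by (simp flip: mult.assoc)
    have "(W has_real_derivative
       (((besD m x / 2 + besQ m x) * sqrt x - (besJ m x / 2 + besP m x) * (inverse (sqrt x) / 2)) / (sqrt x * sqrt x)
          * sin ((x - c) / 2) + cos ((x - c) / 2) * (1 / 2) * ((besJ m x / 2 + besP m x) / sqrt x)
       - ((inverse (sqrt x) / 2 * besJ m x + besD m x * sqrt x) * cos ((x - c) / 2)
          + - sin ((x - c) / 2) * (1 / 2) * (sqrt x * besJ m x)) / 2)) (at x)"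
      unfolding W_def using x by (auto intro!: derivative_eq_intros simp: field_simps sq)
    moreover have "(((besD m x / 2 + besQ m x) * sqrt x - (besJ m x / 2 + besP m x) * (inverse (sqrt x) / 2)) / (sqrt x * sqrt x)
          * sin ((x - c) / 2) + cos ((x - c) / 2) * (1 / 2) * ((besJ m x / 2 + besP m x) / sqrt x)
       - ((inverse (sqrt x) / 2 * besJ m x + besD m x * sqrt x) * cos ((x - c) / 2)
          + - sin ((x - c) / 2) * (1 / 2) * (sqrt x * besJ m x)) / 2) = W' x"
      unfolding W'_def r_def[symmetric] Q besP_eq
      using r by (simp add: field_simps power2_eq_square)
    ultimately show ?thesis by simp
  qed
  have "\<exists>y. c < y \<and> y < b \<and> W b - W c = (b - c) * W' y"
    using MVT2[OF c0(2) DW] by blast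
  then obtain y where y: "c < y" "y < b" "W b - W c = (b - c) * W' y" by blast
  \<comment> \<open>Here \<open>c > 2 * m\<close> enters: m^2 <= y^2 / 4 makes the bracket in
    \<open>W'\<close> at most -1/4 - y^2 / 2.\<close>
  have "(2 * real m)\<^sup>2 \<le> y\<^sup>2"
    using c y by (intro power_mono) auto
  then have "(real m)\<^sup>2 - 1 / 4 - 3 / 4 * y\<^sup>2 < 0"
    by (simp add: power_mult_distrib) (use zero_le_power2[of y] in linarith)
  moreover have "s * besJ m y / (y * sqrt y) * sin ((y - c) / 2) > 0"
    by (intro mult_pos_pos[OF divide_pos_pos[OF pos]] sin_gt_zero) (use y c0 in \<open>auto simp: b_def\<close>)
  ultimately have "(s * besJ m y / (y * sqrt y) * sin ((y - c) / 2)) * ((real m)\<^sup>2 - 1 / 4 - 3 / 4 * y\<^sup>2) < 0"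
    by (rule mult_pos_neg[rotated])
  then have "s * W' y < 0"
    by (simp add: W'_def mult_ac)
  then have "(b - c) * (s * W' y) < 0"
    using c0 by (simp add: mult_pos_neg)
  then have "s * W b - s * W c < 0"
    using y(3) by (metis mult.left_commute right_diff_distrib)
  \<comment> \<open>At both ends the sine vanishes, while the cosine is 1 at \<open>c\<close> and -1
    at \<open>b\<close>. So \<open>s * W\<close> is negative at \<open>c\<close> and positive at
    \<open>b\<close>, against the decrease just found.\<close>
  moreover have "s * W b = sqrt b * (s * besJ m b) / 2"
    by (simp add: W_def b_def)
  moreover have "s * W c = - (sqrt c * (s * besJ m c) / 2)"
    by (simp add: W_def)
  moreover have "sqrt b * (s * besJ m b) > 0" "sqrt c * (s * besJ m c) > 0"
    using pos c0 by auto
  ultimately show False by linarith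
qed

text \<open>Any element beyond \<open>b\<close> bounds a finite nonempty piece of \<open>Z\<close>
  to the right of \<open>b\<close>, and the minimum of that piece is the successor.\<close>

lemma next_element_exists:
  fixes Z :: "real set"
  assumes fin: "\<And>b. finite (Z \<inter> {..b})" and unb: "\<And>b. \<exists>z\<in>Z. z > b"
  shows "\<exists>z\<in>Z. b < z \<and> Z \<inter> {..z} = insert z (Z \<inter> {..b})"
proof -
  obtain u where u: "u \<in> Z" "u > b" using unb by blast
  define T where "T = Z \<inter> {..u} - {..b}"
  have T: "finite T" "T \<noteq> {}" using fin u by (auto simp: T_def)
  then have "Min T \<in> T" "\<And>y. y \<in> T \<Longrightarrow> Min T \<le> y" by auto
  then have "Min T \<in> Z" "Min T > b" "Z \<inter> {..Min T} = insert (Min T) (Z \<inter> {..b})"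
    unfolding T_def by force+
  then show ?thesis by blast
qed

lemma nth_element_exists:
  fixes Z :: "real set"
  assumes fin: "\<And>b. finite (Z \<inter> {..b})" and unb: "\<And>b. \<exists>z\<in>Z. z > b" and low: "\<And>z. z \<in> Z \<Longrightarrow> z > a"
  shows "\<exists>z\<in>Z. card (Z \<inter> {..z}) = Suc n"
proof (induction n)
  case 0
  have "Z \<inter> {..a} = {}" using low by force
  then show ?case using next_element_exists[OF fin unb, of a] by force
next
  case (Suc n)
  then obtain z where z: "z \<in> Z" "card (Z \<inter> {..z}) = Suc n" by blast
  obtain z' where "z' \<in> Z" "Z \<inter> {..z'} = insert z' (Z \<inter> {..z})" "z < z'"
    using next_element_exists[OF fin unb] by blast
  then show ?case using z fin by (intro bexI[of _ z']) auto
qed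

text \<open>This justifies the definite description: zeros are locally finite and unbounded, so the
  n-th one exists, and the number of zeros up to a zero strictly increases from one zero to the
  next, so it is unique.\<close>

lemma bessel_zero_of_nat:
  assumes n: "n \<ge> 1"
  shows "bessel_zero (int m) n > 0" "besJ m (bessel_zero (int m) n) = 0"
proof -
  define Z where "Z = {y. 0 < y \<and> besJ m y = 0}"
  have eq: "{y. 0 < y \<and> y \<le> z \<and> besJ m y = 0} = Z \<inter> {..z}" for z
    by (auto simp: Z_def)
  have fin: "finite (Z \<inter> {..b})" for b
    using finite_besJ_zeros[of b m] by (rule finite_subset[rotated]) (auto simp: Z_def)
  have unb: "\<exists>z\<in>Z. z > b" for b
  proof -
    have "max b (2 * real m) + 1 > 2 * real m" by simp
    from besJ_zero_in_interval[OF this] obtain x where "max b (2 * real m) + 1 \<le> x" "besJ m x = 0" by blast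
    then show ?thesis by (intro bexI[of _ x]) (auto simp: Z_def)
  qed
  obtain z where z: "z \<in> Z" "card (Z \<inter> {..z}) = n"
    using nth_element_exists[OF fin unb, of 0 "n - 1"] n by (auto simp: Z_def)
  have mono: "card (Z \<inter> {..x}) < card (Z \<inter> {..y})" if "x < y" "y \<in> Z" for x y
    by (rule psubset_card_mono[OF fin]) (use that in force)
  have "bessel_zero (int m) n = z"
    unfolding bessel_zero_def bessel_J_of_nat eq
  proof (rule the_equality)
    show "0 < z \<and> besJ m z = 0 \<and> card (Z \<inter> {..z}) = n" using z by (auto simp: Z_def)
    fix y assume y: "0 < y \<and> besJ m y = 0 \<and> card (Z \<inter> {..y}) = n"
    then have "y \<in> Z" by (auto simp: Z_def)
    then show "y = z" using mono[of y z] mono[of z y] z y by (cases y z rule: linorder_cases) auto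
  qed
  then show "bessel_zero (int m) n > 0" "besJ m (bessel_zero (int m) n) = 0"
    using z by (auto simp: Z_def)
qed

section \<open>Bessel integrals\<close>

text \<open>For \<open>a \<noteq> z\<close> Lommel's formula applies, its second term vanishing with
  J_m(z). For \<open>a = z\<close> the substitution x = z r in \<open>lommel_diagonal\<close> gives
  exactly the limiting value built into \<open>bessel_quot\<close>.\<close>

lemma radial_integral:
  assumes z: "z > 0" "besJ m z = 0" and a: "a \<ge> 0"
  shows "((\<lambda>r. r * (besJ m (z * r) * besJ m (a * r))) has_integral
      besP m z * bessel_quot (int m) z a) {0..1}"
proof (cases "a = z")
  case False
  then have ne: "a\<^sup>2 - z\<^sup>2 \<noteq> 0"
    using z a by (simp add: power2_eq_iff)
  have "((\<lambda>r. (1 / (a\<^sup>2 - z\<^sup>2)) * ((a\<^sup>2 - z\<^sup>2) * (r * (besJ m (z * r) * besJ m (a * r))))) has_integral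
      (1 / (a\<^sup>2 - z\<^sup>2)) * (besP m z * besJ m a - besJ m z * besP m a)) {0..1}"
    by (intro has_integral_mult_right lommel)
  then show ?thesis
    using ne False z by (simp add: bessel_quot_def bessel_J_of_nat)
next
  case True
  have "((\<lambda>x. 2 * x * (besJ m x)\<^sup>2) has_integral (besP m z)\<^sup>2) (cbox 0 z)"
    using lommel_diagonal[of z m] z by simp
  from has_integral_affinity[OF this, of z 0]
  have "((\<lambda>r. 2 * (z * r) * (besJ m (z * r))\<^sup>2) has_integral (1 / z * (besP m z)\<^sup>2)) {0..1}"
    using z by (simp add: image_affinity_cbox image_divide_atLeastAtMost)
  from has_integral_mult_right[OF this, of "1 / (2 * z)"]
  have "((\<lambda>r. r * (besJ m (z * r) * besJ m (z * r))) has_integral (besP m z)\<^sup>2 / (2 * z\<^sup>2)) {0..1}"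
    using z by (simp add: power2_eq_square mult_ac)
  moreover have "deriv (bessel_J (int m)) z = besD m z"
    unfolding bessel_J_of_nat[abs_def] by (rule DERIV_imp_deriv[OF DERIV_besJ])
  then have "(besP m z)\<^sup>2 / (2 * z\<^sup>2) = besP m z * bessel_quot (int m) z z"
    using z by (simp add: bessel_quot_def besP_eq power2_eq_square)
  ultimately show ?thesis using True by simp
qed

section \<open>Bessel's integral\<close>

lemma has_integral_cis:
  "((\<lambda>\<theta>. cis (of_int k * \<theta>)) has_integral (if k = 0 then of_real (2 * pi) else 0)) {0..2 * pi}"
proof (cases "k = 0")
  case True
  then show ?thesis
    using has_integral_const_real[of "1::complex" 0 "2 * pi"] by (simp add: scaleR_conv_of_real)
next
  case False
  define F where "F \<theta> = cis (of_int k * \<theta>) / (\<i> * of_int k)" for \<theta>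
  have "((\<lambda>\<theta>. cis (of_int k * \<theta>)) has_integral (F (2 * pi) - F 0)) {0..2 * pi}"
  proof (rule fundamental_theorem_of_calculus)
    fix \<theta>
    have "((\<lambda>\<theta>. cis (of_int k * \<theta>)) has_vector_derivative of_int k *\<^sub>R (\<i> * cis (of_int k * \<theta>))) (at \<theta> within {0..2 * pi})"
      unfolding cis_conv_exp
      by (auto intro!: derivative_eq_intros has_vector_derivative_real_field simp: scaleR_conv_of_real)
    from has_vector_derivative_mult_right[OF this, of "1 / (\<i> * of_int k)"]
    show "(F has_vector_derivative cis (of_int k * \<theta>)) (at \<theta> within {0..2 * pi})"
      using False by (simp add: F_def[abs_def] scaleR_conv_of_real)
  qed simp
  moreover have "cis (of_int k * (2 * pi)) = 1"
    using cis_multiple_2pi[of "of_int k"] by (simp add: mult.commute)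
  ultimately show ?thesis
    using False by (simp add: F_def)
qed

text \<open>The integral of cos(\<theta>)^p e^(-i j \<theta>) over a period, as read off from the
  binomial expansion of ((e^(i \<theta>) + e^(-i \<theta>)) / 2)^p.\<close>

definition cos_moment :: "int \<Rightarrow> nat \<Rightarrow> complex" where
  "cos_moment j p = (\<Sum>q\<le>p. of_nat (p choose q) / 2 ^ p * (if 2 * int q - int p - j = 0 then of_real (2 * pi) else 0))"

lemma has_integral_cos_power:
  "((\<lambda>\<theta>. complex_of_real (cos \<theta>) ^ p * cis (- of_int j * \<theta>)) has_integral cos_moment j p) {0..2 * pi}"
proof -
  have "complex_of_real (cos \<theta>) ^ p * cis (- of_int j * \<theta>)
     = (\<Sum>q\<le>p. of_nat (p choose q) / 2 ^ p * cis (of_int (2 * int q - int p - j) * \<theta>))" for \<theta>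
  proof -
    have "complex_of_real (cos \<theta>) = (cis \<theta> + cis (- \<theta>)) / 2"
      by (simp add: complex_eq_iff)
    then have "complex_of_real (cos \<theta>) ^ p = (\<Sum>q\<le>p. of_nat (p choose q) * cis \<theta> ^ q * cis (- \<theta>) ^ (p - q)) / 2 ^ p"
      by (simp only: power_divide binomial_ring)
    then have "complex_of_real (cos \<theta>) ^ p * cis (- of_int j * \<theta>)
       = (\<Sum>q\<le>p. of_nat (p choose q) / 2 ^ p * (cis \<theta> ^ q * cis (- \<theta>) ^ (p - q) * cis (- of_int j * \<theta>)))"
      by (simp only: sum_divide_distrib sum_distrib_right times_divide_eq_left times_divide_eq_right mult.assoc)
    also have "\<dots> = (\<Sum>q\<le>p. of_nat (p choose q) / 2 ^ p * cis (of_int (2 * int q - int p - j) * \<theta>))"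
    proof (intro sum.cong refl arg_cong2[where f = "(*)"])
      fix q assume "q \<in> {..p}"
      then show "cis \<theta> ^ q * cis (- \<theta>) ^ (p - q) * cis (- of_int j * \<theta>) = cis (of_int (2 * int q - int p - j) * \<theta>)"
        unfolding Complex.DeMoivre cis_mult
        by (intro arg_cong[where f = cis]) (simp add: of_nat_diff algebra_simps)
    qed
    finally show ?thesis .
  qed
  then show ?thesis
    unfolding cos_moment_def
    by (simp only:) (intro has_integral_sum has_integral_mult_right has_integral_cis finite_atMost)
qed

text \<open>Only the index q = (p + j) / 2 contributes. It is \<open>k + |j|\<close> or
  \<open>k\<close> according to the sign of \<open>j\<close>, and both give the same binomial
  coefficient by symmetry.\<close>

lemma cos_moment_eq:
  "cos_moment j (2 * k + nat \<bar>j\<bar>) = of_real (2 * pi) * of_nat ((2 * k + nat \<bar>j\<bar>) choose k) / 2 ^ (2 * k + nat \<bar>j\<bar>)"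
proof -
  define p where "p = 2 * k + nat \<bar>j\<bar>"
  define r where "r = (if j \<ge> 0 then k + nat \<bar>j\<bar> else k)"
  have "2 * int q - int p - j = 0 \<longleftrightarrow> q = r" for q
    by (auto simp: p_def r_def)
  then have "cos_moment j p = (\<Sum>q\<le>p. if q = r then of_nat (p choose r) / 2 ^ p * of_real (2 * pi) else 0)"
    unfolding cos_moment_def by (intro sum.cong) auto
  also have "\<dots> = of_nat (p choose r) / 2 ^ p * of_real (2 * pi)"
    by (simp add: p_def r_def)
  also have "p choose r = p choose k"
    using binomial_symmetric[of k p] by (auto simp: p_def r_def)
  finally show ?thesis
    by (simp add: p_def mult_ac)
qed

lemma cos_moment_eq_0:
  assumes "p \<notin> range (\<lambda>k. 2 * k + nat \<bar>j\<bar>)"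
  shows "cos_moment j p = 0"
  unfolding cos_moment_def
proof (intro sum.neutral ballI)
  fix q assume q: "q \<in> {..p}"
  have "2 * int q - int p - j \<noteq> 0"
  proof
    assume eq: "2 * int q - int p - j = 0"
    show False
    proof (cases "j \<ge> 0")
      case True
      then have "p = 2 * (q - nat \<bar>j\<bar>) + nat \<bar>j\<bar>" using eq q by auto
      then show False using assms by blast
    next
      case False
      then have "p = 2 * q + nat \<bar>j\<bar>" using eq by auto
      then show False using assms by blast
    qed
  qed
  then show "of_nat (p choose q) / 2 ^ p * (if 2 * int q - int p - j = 0 then of_real (2 * pi) else 0) = (0::complex)"
    by simp
qed

text \<open>The exponential series in y cos \<theta> converges uniformly and is integrated term by
  term. Only the moments with p = 2 k + |j| survive, and they produce the series of J_|j|, for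
  either sign of \<open>j\<close>.\<close>

lemma bessel_integral:
  "((\<lambda>\<theta>. cis (y * cos \<theta>) * cis (- of_int j * \<theta>)) has_integral
      (of_real (2 * pi) * \<i> ^ nat \<bar>j\<bar> * of_real (besJ (nat \<bar>j\<bar>) y))) {0..2 * pi}"
proof -
  define n where "n = nat \<bar>j\<bar>"
  define c where "c p = (\<i> * of_real y) ^ p / fact p" for p
  define t where "t p \<theta> = c p * (complex_of_real (cos \<theta>) ^ p * cis (- of_int j * \<theta>))" for p \<theta>
  have c_norm: "norm (t p \<theta>) \<le> inverse (fact p) * \<bar>y\<bar> ^ p" for p \<theta>
  proof -
    have "norm (t p \<theta>) = \<bar>y\<bar> ^ p / fact p * \<bar>cos \<theta>\<bar> ^ p"
      by (simp add: t_def c_def norm_mult norm_divide norm_power)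
    also have "\<dots> \<le> \<bar>y\<bar> ^ p / fact p * 1"
      by (intro mult_left_mono power_le_one) auto
    finally show ?thesis by (simp add: field_simps)
  qed
  have unif: "uniform_limit {0..2 * pi} (\<lambda>N \<theta>. \<Sum>p<N. t p \<theta>) (\<lambda>\<theta>. \<Sum>p. t p \<theta>) sequentially"
    by (rule Weierstrass_m_test[OF c_norm summable_exp])
  have lim: "(\<Sum>p. t p \<theta>) = cis (y * cos \<theta>) * cis (- of_int j * \<theta>)" for \<theta>
  proof -
    have "(\<lambda>p. (\<i> * of_real (y * cos \<theta>)) ^ p /\<^sub>R fact p) sums exp (\<i> * of_real (y * cos \<theta>))"
      by (rule exp_converges)
    from sums_mult2[OF this, of "cis (- of_int j * \<theta>)"]
    have "(\<lambda>p. t p \<theta>) sums (exp (\<i> * of_real (y * cos \<theta>)) * cis (- of_int j * \<theta>))"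
      by (simp add: t_def c_def scaleR_conv_of_real power_mult_distrib divide_inverse mult_ac)
    then show ?thesis
      by (simp add: sums_iff cis_conv_exp)
  qed
  have int_t: "(t p has_integral c p * cos_moment j p) {0..2 * pi}" for p
    unfolding t_def[abs_def] by (intro has_integral_mult_right has_integral_cos_power)
  have cont: "continuous_on {0..2 * pi} (\<lambda>\<theta>. \<Sum>p<N. t p \<theta>)" for N
    unfolding t_def cis_conv_exp by (intro continuous_intros)
  obtain I J where IJ: "\<And>N. ((\<lambda>\<theta>. \<Sum>p<N. t p \<theta>) has_integral I N) {0..2 * pi}"
    "((\<lambda>\<theta>. \<Sum>p. t p \<theta>) has_integral J) {0..2 * pi}" "I \<longlonglongrightarrow> J"
    using uniform_limit_integral[OF unif cont] by auto
  have "I = (\<lambda>N. \<Sum>p<N. c p * cos_moment j p)"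
    by (rule ext, rule has_integral_unique[OF IJ(1)]) (intro has_integral_sum int_t finite_lessThan)
  then have "(\<lambda>p. c p * cos_moment j p) sums J"
    using IJ(3) by (simp add: sums_def)
  \<comment> \<open>The sum is restricted to the exponents \<open>2 * k + n\<close>, since the other
    moments are zero.\<close>
  then have "(\<lambda>k. c (2 * k + n) * cos_moment j (2 * k + n)) sums J"
    by (subst sums_mono_reindex) (auto simp: strict_mono_def n_def cos_moment_eq_0)
  moreover have "c (2 * k + n) * cos_moment j (2 * k + n) = of_real (2 * pi) * \<i> ^ n *
      of_real ((y / 2) ^ n * ((-1) ^ k / (fact k * fact (k + n)) * ((y / 2)\<^sup>2) ^ k))" for k
  proof -
    define p where "p = 2 * k + n"
    have binom: "complex_of_nat (p choose k) = fact p / (fact k * fact (k + n))"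
      using binomial_fact[of k p, where ?'a = complex] by (simp add: p_def)
    have i_pow: "\<i> ^ p = (-1) ^ k * \<i> ^ n"
      by (simp add: p_def power_add power_mult)
    have sq: "((y / 2)\<^sup>2) ^ k = (y / 2) ^ (2 * k)"
      by (simp only: power_mult)
    have y_pow: "(y / 2) ^ n * ((-1) ^ k / (fact k * fact (k + n)) * ((y / 2)\<^sup>2) ^ k)
        = (-1) ^ k * (y ^ p / 2 ^ p) / (fact k * fact (k + n))"
      unfolding sq p_def by (simp add: power_divide power_add mult_ac)
    have "cos_moment j p = of_real (2 * pi) * of_nat (p choose k) / 2 ^ p"
      using cos_moment_eq[of j k] by (simp only: p_def n_def)
    then show ?thesis
      unfolding p_def[symmetric] y_pow c_def power_mult_distrib i_pow binom by (simp add: mult_ac)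
  qed
  moreover have "(\<lambda>k. complex_of_real (2 * pi) * \<i> ^ n *
      of_real ((y / 2) ^ n * ((-1) ^ k / (fact k * fact (k + n)) * ((y / 2)\<^sup>2) ^ k))) sums
      (of_real (2 * pi) * \<i> ^ n * of_real (besJ n y))"
    unfolding besJ_def bessel_E_def
    by (intro sums_mult sums_of_real summable_sums summable_bessel_E)
  ultimately have "J = of_real (2 * pi) * \<i> ^ n * of_real (besJ n y)"
    using sums_unique2 by (metis (no_types, lifting) ext)
  then show ?thesis
    using IJ(2) by (simp add: lim n_def)
qed

section \<open>Rotations and polar integrals\<close>

text \<open>\<open>C_diff\<close> speaks of the coordinate axes only; total differentiability is
  what gives derivatives along rotated axes.\<close>

lemma has_derivative_of_partials:
  fixes g :: "real \<times> real \<Rightarrow> complex"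
  assumes p1: "\<And>x y. ((\<lambda>t. g (t, y)) has_vector_derivative g1 (x, y)) (at x)"
    and p2: "\<And>x y. ((\<lambda>t. g (x, t)) has_vector_derivative g2 (x, y)) (at y)"
    and c2: "continuous_on UNIV g2"
  shows "(g has_derivative (\<lambda>h. fst h *\<^sub>R g1 p + snd h *\<^sub>R g2 p)) (at p)"
proof -
  obtain x y where p: "p = (x, y)" by (cases p)
  have "((\<lambda>(x, y). g (x, y)) has_derivative
      (\<lambda>(tx, ty). tx *\<^sub>R g1 (x, y) + blinfun_scaleR_left (g2 (x, y)) ty)) (at (x, y) within UNIV \<times> UNIV)"
  proof (rule has_derivative_partialsI)
    show "((\<lambda>x. g (x, y)) has_derivative (\<lambda>tx. tx *\<^sub>R g1 (x, y))) (at x within UNIV)"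
      using p1[of y x] by (simp add: has_vector_derivative_def)
    show "((\<lambda>y. g (x, y)) has_derivative blinfun_apply (blinfun_scaleR_left (g2 (x, y)))) (at y within UNIV)" for x y
      using p2[of x y] by (simp add: has_vector_derivative_def blinfun_scaleR_left.rep_eq)
    have "continuous_on UNIV (\<lambda>p. blinfun_scaleR_left (g2 p))"
      by (intro bounded_linear.continuous_on[OF bounded_linear_blinfun_scaleR_left] c2)
    then show "continuous (at (x, y) within UNIV \<times> UNIV) (\<lambda>(x, y). blinfun_scaleR_left (g2 (x, y)))"
      unfolding continuous_on_eq_continuous_within by (simp add: case_prod_eta[of "\<lambda>p. blinfun_scaleR_left (g2 p)"])
  qed auto
  then show ?thesis
    by (simp add: p blinfun_scaleR_left.rep_eq case_prod_unfold)
qed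

lemma has_vector_derivative_along_line:
  fixes g :: "real \<times> real \<Rightarrow> complex"
  assumes "\<And>x y. ((\<lambda>t. g (t, y)) has_vector_derivative g1 (x, y)) (at x)"
    and "\<And>x y. ((\<lambda>t. g (x, t)) has_vector_derivative g2 (x, y)) (at y)"
    and "continuous_on UNIV g2"
  shows "((\<lambda>t. g (p + t *\<^sub>R v)) has_vector_derivative
      fst v *\<^sub>R g1 (p + t *\<^sub>R v) + snd v *\<^sub>R g2 (p + t *\<^sub>R v)) (at t within S)"
proof -
  have "((\<lambda>t. p + t *\<^sub>R v) has_derivative (\<lambda>t. t *\<^sub>R v)) (at t within S)"
    by (auto intro!: derivative_eq_intros)
  from has_derivative_compose[OF this has_derivative_of_partials[OF assms]]
  show ?thesis
    by (simp add: has_vector_derivative_def scaleR_add_right)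
qed

lemma vector_derivative_bound:
  fixes f :: "real \<Rightarrow> complex"
  assumes "\<And>x. x \<in> {a..b} \<Longrightarrow> (f has_vector_derivative f' x) (at x within {a..b})"
    and "\<And>x. x \<in> {a..b} \<Longrightarrow> norm (f' x) \<le> B" and "x \<in> {a..b}" "y \<in> {a..b}"
  shows "norm (f x - f y) \<le> B * \<bar>x - y\<bar>"
proof -
  have "norm (f x - f y) \<le> B * norm (x - y)"
  proof (rule differentiable_bound[of "{a..b}" f "\<lambda>x h. h *\<^sub>R f' x"])
    show "onorm (\<lambda>h. h *\<^sub>R f' x) \<le> B" if "x \<in> {a..b}" for x
      by (rule onorm_le) (use assms(2)[OF that] mult_left_mono in \<open>fastforce simp: mult.commute[of B]\<close>)
  qed (use assms in \<open>auto simp: has_vector_derivative_def\<close>)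
  then show ?thesis by simp
qed

lemma C_diff_2_second_difference:
  assumes "C_diff 2 f"
  shows "\<exists>C. \<forall>p v h. norm p \<le> 2 \<longrightarrow> norm v \<le> 1 \<longrightarrow> 0 \<le> h \<longrightarrow> h \<le> 1 \<longrightarrow>
    norm (f (p + h *\<^sub>R v) - 2 * f p + f (p - h *\<^sub>R v)) \<le> C * h\<^sup>2"
proof -
  have "C_diff (Suc (Suc 0)) f" using assms by (simp add: numeral_2_eq_2)
  then obtain f1 f2 where f:
    "\<And>x y. ((\<lambda>t. f (t, y)) has_vector_derivative f1 (x, y)) (at x)"
    "\<And>x y. ((\<lambda>t. f (x, t)) has_vector_derivative f2 (x, y)) (at y)"
    and "C_diff (Suc 0) f1" "C_diff (Suc 0) f2"
    unfolding C_diff.simps(2)[of "Suc 0"] by blast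
  then obtain f11 f12 f21 f22 where f1:
    "\<And>x y. ((\<lambda>t. f1 (t, y)) has_vector_derivative f11 (x, y)) (at x)"
    "\<And>x y. ((\<lambda>t. f1 (x, t)) has_vector_derivative f12 (x, y)) (at y)"
    and f2: "\<And>x y. ((\<lambda>t. f2 (t, y)) has_vector_derivative f21 (x, y)) (at x)"
    "\<And>x y. ((\<lambda>t. f2 (x, t)) has_vector_derivative f22 (x, y)) (at y)"
    and cont: "continuous_on UNIV f2" "continuous_on UNIV f11" "continuous_on UNIV f12"
      "continuous_on UNIV f21" "continuous_on UNIV f22"
    unfolding C_diff.simps by blast
  define S where "S q = norm (f11 q) + norm (f12 q) + norm (f21 q) + norm (f22 q)" for q
  \<comment> \<open>Radius 3 contains every point \<open>p + t *\<^sub>R v\<close> with |p| <= 2,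
    |t| <= 1 and |v| <= 1.\<close>
  have "continuous_on (cball 0 3) S"
    unfolding S_def by (intro continuous_intros cont[THEN continuous_on_subset]) auto
  then have "bounded (S ` cball 0 3)"
    by (intro compact_imp_bounded compact_continuous_image) auto
  then obtain B where B: "\<forall>x\<in>S ` cball 0 3. norm x \<le> B"
    unfolding bounded_iff by blast
  then have B: "S q \<le> B" if "norm q \<le> 3" for q
    using that by (fastforce simp: abs_le_iff)
  have "norm (f (p + h *\<^sub>R v) - 2 * f p + f (p - h *\<^sub>R v)) \<le> 2 * B * h\<^sup>2"
    if p: "norm p \<le> 2" and v: "norm v \<le> 1" and h: "0 \<le> h" "h \<le> 1" for p v :: "real \<times> real" and h :: real
  proof -
    have v12: "\<bar>fst v\<bar> \<le> 1" "\<bar>snd v\<bar> \<le> 1"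
      using v norm_fst_le[of "fst v" "snd v"] norm_snd_le[of "snd v" "fst v"] by auto
    define \<phi>1 where "\<phi>1 t = fst v *\<^sub>R f1 (p + t *\<^sub>R v) + snd v *\<^sub>R f2 (p + t *\<^sub>R v)" for t
    define \<phi>2 where "\<phi>2 t = fst v *\<^sub>R (fst v *\<^sub>R f11 (p + t *\<^sub>R v) + snd v *\<^sub>R f12 (p + t *\<^sub>R v))
       + snd v *\<^sub>R (fst v *\<^sub>R f21 (p + t *\<^sub>R v) + snd v *\<^sub>R f22 (p + t *\<^sub>R v))" for t
    have d0: "((\<lambda>t. f (p + t *\<^sub>R v)) has_vector_derivative \<phi>1 t) (at t within X)" for t X
      unfolding \<phi>1_def by (rule has_vector_derivative_along_line[OF f cont(1)])
    have d1: "(\<phi>1 has_vector_derivative \<phi>2 t) (at t within X)" for t X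
      unfolding \<phi>1_def[abs_def] \<phi>2_def
      by (intro has_vector_derivative_add bounded_linear.has_vector_derivative[OF bounded_linear_scaleR_right]
            has_vector_derivative_along_line f1 f2 cont)
    have \<phi>2_bound: "norm (\<phi>2 t) \<le> B" if t: "t \<in> {-1..1}" for t
    proof -
      have "norm (p + t *\<^sub>R v) \<le> norm p + \<bar>t\<bar> * norm v"
        by (rule order_trans[OF norm_triangle_ineq]) simp
      also have "\<dots> \<le> 2 + 1 * 1"
        using p v t by (intro add_mono mult_mono) auto
      finally have "S (p + t *\<^sub>R v) \<le> B" using B by simp
      have le: "norm (a *\<^sub>R x) \<le> norm x" if "\<bar>a\<bar> \<le> 1" for a and x :: complex
        using mult_right_mono[OF that, of "norm x"] by simp
      have "norm (\<phi>2 t) \<le> S (p + t *\<^sub>R v)"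
        unfolding \<phi>2_def S_def
        using le[OF v12(1), of "fst v *\<^sub>R f11 (p + t *\<^sub>R v) + snd v *\<^sub>R f12 (p + t *\<^sub>R v)"]
          le[OF v12(2), of "fst v *\<^sub>R f21 (p + t *\<^sub>R v) + snd v *\<^sub>R f22 (p + t *\<^sub>R v)"]
          le[OF v12(1), of "f11 (p + t *\<^sub>R v)"] le[OF v12(2), of "f12 (p + t *\<^sub>R v)"]
          le[OF v12(1), of "f21 (p + t *\<^sub>R v)"] le[OF v12(2), of "f22 (p + t *\<^sub>R v)"]
        by (smt (verit) norm_triangle_ineq)
      then show ?thesis using \<open>S (p + t *\<^sub>R v) \<le> B\<close> by simp
    qed
    have B0: "B \<ge> 0" by (rule order_trans[OF norm_ge_zero \<phi>2_bound[of 0]]) simp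
    define \<psi> where "\<psi> t = f (p + t *\<^sub>R v) + f (p + (- t) *\<^sub>R v)" for t
    have "(\<psi> has_vector_derivative \<phi>1 t - \<phi>1 (- t)) (at t within X)" for t X
    proof -
      have "((\<lambda>t. f (p + (- t) *\<^sub>R v)) has_vector_derivative - \<phi>1 (- t)) (at t within X)"
        using vector_diff_chain_within[OF has_vector_derivative_minus[OF has_vector_derivative_id] d0[of "- t"]]
        by (simp add: o_def)
      from has_vector_derivative_add[OF d0 this] show ?thesis
        by (simp add: \<psi>_def[abs_def])
    qed
    moreover have "norm (\<phi>1 t - \<phi>1 (- t)) \<le> 2 * B * h" if t: "t \<in> {0..h}" for t
    proof -
      have "norm (\<phi>1 t - \<phi>1 (- t)) \<le> B * \<bar>t - (- t)\<bar>"
        by (rule vector_derivative_bound[of "-1" 1 \<phi>1, OF d1 \<phi>2_bound]) (use t h in auto)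
      also have "\<dots> \<le> B * (2 * h)" using t B0 by (intro mult_left_mono) auto
      finally show ?thesis by (simp add: mult_ac)
    qed
    ultimately have "norm (\<psi> h - \<psi> 0) \<le> 2 * B * h * \<bar>h - 0\<bar>"
      by (intro vector_derivative_bound[of 0 h]) (use h in auto)
    moreover have "\<psi> h - \<psi> 0 = f (p + h *\<^sub>R v) - 2 * f p + f (p - h *\<^sub>R v)"
      by (simp add: \<psi>_def algebra_simps)
    ultimately show ?thesis
      using h by (simp add: power2_eq_square mult_ac)
  qed
  then show ?thesis by blast
qed

section \<open>Rotations in Cartesian form\<close>

definition rot :: "real \<Rightarrow> real \<times> real \<Rightarrow> real \<times> real" where
  "rot \<phi> p = (fst p * cos \<phi> - snd p * sin \<phi>, fst p * sin \<phi> + snd p * cos \<phi>)"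

lemma polar_decomposition: "from_polar (norm p) (polar_angle p) = p"
proof -
  have "norm p = cmod (Complex (fst p) (snd p))"
    by (cases p) (simp add: norm_Pair cmod_def)
  then have "Complex (norm p * cos (polar_angle p)) (norm p * sin (polar_angle p)) = Complex (fst p) (snd p)"
    using rcis_cmod_Arg[of "Complex (fst p) (snd p)"]
    by (simp add: polar_angle_def complex_eq_iff)
  then show ?thesis
    by (cases p) (simp add: from_polar_def)
qed

lemma rot_from_polar: "rot \<phi> (from_polar r \<theta>) = from_polar r (\<theta> + \<phi>)"
  by (simp add: rot_def from_polar_def cos_add sin_add algebra_simps)

text \<open>Every point is recovered from its norm and angle, and \<open>rot\<close> adds to the
  angle. From here on the branch of \<open>Arg\<close> plays no part in rotating functions.\<close>

lemma rotate_fun_eq: "rotate_fun \<phi> f = f \<circ> rot \<phi>"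
  unfolding rotate_fun_def[abs_def] o_def
  by (metis rot_from_polar polar_decomposition)

lemma norm_from_polar: "norm (from_polar r \<theta>) = \<bar>r\<bar>"
proof -
  have "(r * cos \<theta>)\<^sup>2 + (r * sin \<theta>)\<^sup>2 = r\<^sup>2"
    by (simp add: power_mult_distrib flip: distrib_left)
  then show ?thesis by (simp add: from_polar_def norm_Pair)
qed

lemma norm_rot: "norm (rot \<phi> p) = norm p"
  by (metis norm_from_polar polar_decomposition rot_from_polar)

lemma continuous_on_rot: "continuous_on A (rot \<phi>)"
  unfolding rot_def by (intro continuous_intros)

text \<open>Axis steps before the rotation become steps along unit vectors after it, with base
  points of norm at most 2, so the directional bound applies with a constant independent of
  \<open>\<phi>\<close>.\<close>

lemma smooth_bump_rot:
  assumes "C_diff 2 f" "supported_in f (ball 0 1)"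
  shows "\<exists>C. \<forall>\<phi>. smooth_bump C (f \<circ> rot \<phi>)"
proof -
  obtain C where C: "\<And>p v h. norm p \<le> 2 \<Longrightarrow> norm v \<le> 1 \<Longrightarrow> 0 \<le> h \<Longrightarrow> h \<le> 1 \<Longrightarrow>
    norm (f (p + h *\<^sub>R v) - 2 * f p + f (p - h *\<^sub>R v)) \<le> C * h\<^sup>2"
    using C_diff_2_second_difference[OF assms(1)] by blast
  have cont: "continuous_on UNIV f"
    using assms(1) by (simp add: numeral_2_eq_2)
  have zero: "f p = 0" if "norm p \<ge> 1" for p
    using assms(2) that by (force simp: supported_in_def dist_norm)
  have "smooth_bump C (f \<circ> rot \<phi>)" for \<phi>
    unfolding smooth_bump_def
  proof (intro conjI allI impI)
    show "continuous_on UNIV (f \<circ> rot \<phi>)"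
      by (intro continuous_on_compose continuous_on_rot continuous_on_subset[OF cont]) auto
    show "(f \<circ> rot \<phi>) p = 0" if "1 \<le> norm p" for p
      using zero that by (simp add: norm_rot)
    fix x y h :: real
    assume xy: "\<bar>x\<bar> \<le> 1" "\<bar>y\<bar> \<le> 1" and h: "0 \<le> h" "h \<le> 1"
    have "norm (x, y) \<le> norm x + norm y" by (rule norm_Pair_le)
    then have p: "norm (rot \<phi> (x, y)) \<le> 2" using xy by (simp add: norm_rot)
    have "norm (cos \<phi>, sin \<phi>) \<le> 1" "norm (- sin \<phi>, cos \<phi>) \<le> 1"
      by (simp_all add: norm_Pair)
    moreover have "rot \<phi> (x + h, y) = rot \<phi> (x, y) + h *\<^sub>R (cos \<phi>, sin \<phi>)"
      "rot \<phi> (x - h, y) = rot \<phi> (x, y) - h *\<^sub>R (cos \<phi>, sin \<phi>)"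
      "rot \<phi> (x, y + h) = rot \<phi> (x, y) + h *\<^sub>R (- sin \<phi>, cos \<phi>)"
      "rot \<phi> (x, y - h) = rot \<phi> (x, y) - h *\<^sub>R (- sin \<phi>, cos \<phi>)"
      by (simp_all add: rot_def algebra_simps)
    ultimately show
      "norm ((f \<circ> rot \<phi>) (x + h, y) - 2 * (f \<circ> rot \<phi>) (x, y) + (f \<circ> rot \<phi>) (x - h, y)) \<le> C * h\<^sup>2"
      "norm ((f \<circ> rot \<phi>) (x, y + h) - 2 * (f \<circ> rot \<phi>) (x, y) + (f \<circ> rot \<phi>) (x, y - h)) \<le> C * h\<^sup>2"
      unfolding o_def using C[OF p _ h] by (simp_all only:)
  qed
  then show ?thesis by blast
qed

section \<open>Weighted integrals over the disk in polar coordinates\<close>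

text \<open>The part of the shifted interval beyond 2 pi is translated back by one period. A
  negative shift is first increased by 2 pi.\<close>

lemma integral_periodic_shift:
  fixes h :: "real \<Rightarrow> complex"
  assumes cont: "continuous_on UNIV h" and per: "\<And>x. h (x + 2 * pi) = h x" and c: "\<bar>c\<bar> \<le> 2 * pi"
  shows "integral {0..2 * pi} (\<lambda>\<theta>. h (\<theta> + c)) = integral {0..2 * pi} h"
proof -
  have int: "h integrable_on {a..b}" for a b
    by (intro integrable_continuous_interval continuous_on_subset[OF cont]) auto
  have shift: "integral {a..b} (\<lambda>\<theta>. h (\<theta> + c)) = integral {a + c..b + c} h" for a b c
    using integral_shift_Icc_real[of a b h c] by (simp add: o_def add.commute)
  have pos: "integral {0..2 * pi} (\<lambda>\<theta>. h (\<theta> + c)) = integral {0..2 * pi} h" if c: "0 \<le> c" "c \<le> 2 * pi" for c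
  proof -
    have "integral {0..2 * pi} (\<lambda>\<theta>. h (\<theta> + c)) = integral {c..2 * pi + c} h"
      using shift[of 0 "2 * pi" c] by simp
    also have "\<dots> = integral {c..2 * pi} h + integral {2 * pi..2 * pi + c} h"
      using c by (intro Henstock_Kurzweil_Integration.integral_combine[symmetric] int) auto
    also have "integral {2 * pi..2 * pi + c} h = integral {0..c} h"
      using shift[of 0 c "2 * pi"] by (simp add: per add.commute)
    also have "integral {c..2 * pi} h + integral {0..c} h = integral {0..2 * pi} h"
      unfolding add.commute[of "integral {c..2 * pi} h"]
      using c by (intro Henstock_Kurzweil_Integration.integral_combine int) auto
    finally show ?thesis .
  qed
  show ?thesis
  proof (cases "c \<ge> 0")
    case True
    then show ?thesis using pos[of c] c by simp
  next
    case False
    have "h (\<theta> + c) = h (\<theta> + (c + 2 * pi))" for \<theta>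
      using per[of "\<theta> + c"] by (simp add: add.assoc)
    then show ?thesis using pos[of "c + 2 * pi"] False c by simp
  qed
qed

text \<open>The argument is the pair (r, \<theta>), and the factor r is the Jacobian. Order |j| in
  place of \<open>j\<close> changes the weight at most by a sign.\<close>

definition polar_weight :: "int \<Rightarrow> real \<Rightarrow> real \<times> real \<Rightarrow> complex" where
  "polar_weight j z q = of_real (fst q * besJ (nat \<bar>j\<bar>) (z * fst q)) * cis (- of_int j * snd q)"

definition polar_integral :: "int \<Rightarrow> real \<Rightarrow> (real \<times> real \<Rightarrow> complex) \<Rightarrow> complex" where
  "polar_integral j z F = integral (cbox (0, 0) (1, 2 * pi)) (\<lambda>q. polar_weight j z q * F (from_polar (fst q) (snd q)))"

lemma continuous_on_polar_weight: "continuous_on A (polar_weight j z)"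
  unfolding polar_weight_def cis_conv_exp by (intro continuous_intros)

lemma continuous_on_polar_integrand:
  assumes "continuous_on UNIV F"
  shows "continuous_on A (\<lambda>q. polar_weight j z q * F (from_polar (fst q) (snd q)))"
  by (intro continuous_intros continuous_on_polar_weight continuous_on_compose2[OF assms])
     (auto simp: from_polar_def intro!: continuous_intros)

lemma integrable_polar:
  "continuous_on UNIV F \<Longrightarrow>
    (\<lambda>q. polar_weight j z q * F (from_polar (fst q) (snd q))) integrable_on cbox (0, 0) (1, 2 * pi)"
  by (intro integrable_continuous continuous_on_polar_integrand)

lemma polar_integral_diff:
  assumes "continuous_on UNIV F" "continuous_on UNIV G"
  shows "polar_integral j z (\<lambda>p. F p - G p) = polar_integral j z F - polar_integral j z G"
  unfolding polar_integral_def right_diff_distrib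
  by (intro Henstock_Kurzweil_Integration.integral_diff integrable_polar assms)

lemma polar_integral_sum:
  assumes "finite S" "\<And>k. k \<in> S \<Longrightarrow> continuous_on UNIV (F k)"
  shows "polar_integral j z (\<lambda>p. \<Sum>k\<in>S. a k * F k p) = (\<Sum>k\<in>S. a k * polar_integral j z (F k))"
proof -
  have "polar_integral j z (\<lambda>p. \<Sum>k\<in>S. a k * F k p)
    = integral (cbox (0, 0) (1, 2 * pi)) (\<lambda>q. \<Sum>k\<in>S. a k * (polar_weight j z q * F k (from_polar (fst q) (snd q))))"
    unfolding polar_integral_def by (simp add: sum_distrib_left mult_ac)
  also have "\<dots> = (\<Sum>k\<in>S. integral (cbox (0, 0) (1, 2 * pi)) (\<lambda>q. a k * (polar_weight j z q * F k (from_polar (fst q) (snd q)))))"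
    by (intro Henstock_Kurzweil_Integration.integral_sum assms integrable_on_mult_right integrable_polar)
  also have "\<dots> = (\<Sum>k\<in>S. a k * polar_integral j z (F k))"
    unfolding polar_integral_def by simp
  finally show ?thesis .
qed

text \<open>The weight is bounded on the compact rectangle. The constant is independent of
  \<open>F\<close>, as it must be to pass from a uniform error of interpolation to an error of
  integrals.\<close>

lemma polar_integral_bound:
  "\<exists>B\<ge>0. \<forall>F b. continuous_on UNIV F \<longrightarrow> (\<forall>p. norm p \<le> 1 \<longrightarrow> norm (F p) \<le> b) \<longrightarrow>
     norm (polar_integral j z F) \<le> B * b"
proof -
  let ?R = "cbox (0, 0) (1, 2 * pi) :: (real \<times> real) set"
  have "bounded (polar_weight j z ` ?R)"
    by (intro compact_imp_bounded compact_continuous_image continuous_on_polar_weight compact_cbox)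
  then obtain W where W: "\<And>q. q \<in> ?R \<Longrightarrow> norm (polar_weight j z q) \<le> W"
    unfolding bounded_iff by blast
  have "(0, 0) \<in> ?R" by (auto simp: cbox_Pair_eq)
  then have W0: "W \<ge> 0" by (rule order_trans[OF norm_ge_zero W])
  have "norm (polar_integral j z F) \<le> (W * measure lborel ?R) * b"
    if F: "continuous_on UNIV F" "\<And>p. norm p \<le> 1 \<Longrightarrow> norm (F p) \<le> b" for F b
  proof -
    have b0: "b \<ge> 0" by (rule order_trans[OF norm_ge_zero F(2)[of 0]]) simp
    have "norm (polar_integral j z F) \<le> (W * b) * measure lborel ?R"
    proof (rule has_integral_bound)
      show "((\<lambda>q. polar_weight j z q * F (from_polar (fst q) (snd q))) has_integral polar_integral j z F) ?R"
        unfolding polar_integral_def using integrable_polar[OF F(1)] by (rule integrable_integral)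
      fix q assume q: "q \<in> ?R"
      then have "norm (from_polar (fst q) (snd q)) \<le> 1"
        by (auto simp: norm_from_polar cbox_Pair_eq)
      then show "norm (polar_weight j z q * F (from_polar (fst q) (snd q))) \<le> W * b"
        unfolding norm_mult by (intro mult_mono W q F W0) auto
    qed (use W0 b0 in simp)
    then show ?thesis by (simp add: mult_ac)
  qed
  then show ?thesis
    using W0 by (intro exI[of _ "W * measure lborel ?R"]) auto
qed

lemma polar_integral_iterated:
  assumes "continuous_on UNIV F"
  shows "polar_integral j z F = integral {0..1} (\<lambda>r. of_real (r * besJ (nat \<bar>j\<bar>) (z * r)) *
     integral {0..2 * pi} (\<lambda>\<theta>. cis (- of_int j * \<theta>) * F (from_polar r \<theta>)))"
  unfolding polar_integral_def
  using integral_prod_continuous[OF continuous_on_polar_integrand[OF assms], of 0 0 1 "2 * pi" j z]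
  by (simp add: polar_weight_def mult.assoc)

lemma from_polar_periodic: "from_polar r (\<theta> + 2 * pi) = from_polar r \<theta>"
  by (simp add: from_polar_def)

text \<open>The integrand has period 2 pi because \<open>j\<close> is an integer. The identity is
  used twice: for the rotation law and for turning a wave vector onto the first axis.\<close>

lemma polar_angular_shift:
  assumes F: "continuous_on UNIV F" and c: "\<bar>c\<bar> \<le> 2 * pi"
  shows "integral {0..2 * pi} (\<lambda>\<theta>. cis (- of_int j * \<theta>) * F (from_polar r (\<theta> + c)))
     = cis (of_int j * c) * integral {0..2 * pi} (\<lambda>\<theta>. cis (- of_int j * \<theta>) * F (from_polar r \<theta>))"
proof -
  define h where "h \<theta> = cis (- of_int j * \<theta>) * F (from_polar r \<theta>)" for \<theta>
  have "continuous_on UNIV h"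
    unfolding h_def cis_conv_exp
    by (intro continuous_intros continuous_on_compose2[OF F]) (auto simp: from_polar_def intro!: continuous_intros)
  moreover have "h (x + 2 * pi) = h x" for x
  proof -
    have "cis (- of_int j * (x + 2 * pi)) = cis (- of_int j * x) * cis (2 * pi * of_int (- j))"
      by (simp add: cis_mult algebra_simps)
    moreover have "cis (2 * pi * of_int (- j)) = 1"
      by (rule cis_multiple_2pi) simp
    ultimately show ?thesis
      unfolding h_def from_polar_periodic by simp
  qed
  ultimately have "integral {0..2 * pi} (\<lambda>\<theta>. h (\<theta> + c)) = integral {0..2 * pi} h"
    using c by (rule integral_periodic_shift)
  moreover have "cis (- of_int j * \<theta>) * F (from_polar r (\<theta> + c)) = cis (of_int j * c) * h (\<theta> + c)" for \<theta>
    unfolding h_def mult.assoc[symmetric] cis_mult by (simp add: algebra_simps)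
  ultimately show ?thesis
    by (simp only: integral_mult_right) (simp only: h_def[abs_def])
qed

lemma polar_integral_rot:
  assumes F: "continuous_on UNIV F" and c: "\<bar>\<phi>\<bar> \<le> 2 * pi"
  shows "polar_integral j z (F \<circ> rot \<phi>) = cis (of_int j * \<phi>) * polar_integral j z F"
proof -
  have "continuous_on UNIV (F \<circ> rot \<phi>)"
    by (intro continuous_on_compose continuous_on_rot continuous_on_subset[OF F]) auto
  from polar_integral_iterated[OF this] show ?thesis
    unfolding polar_integral_iterated[OF F] o_apply rot_from_polar polar_angular_shift[OF F c]
    by (simp add: mult.left_commute)
qed

text \<open>In polar coordinates the wave is \<open>cis (a * r * cos (\<theta> - \<Phi>))\<close>.
  Shifting the angle by \<open>\<Phi>\<close> extracts the phase, Bessel's integral evaluates the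
  angular part, and \<open>radial_integral\<close> the rest.\<close>

lemma polar_integral_plane_wave:
  assumes z: "z > 0" "besJ (nat \<bar>j\<bar>) z = 0"
  shows "polar_integral j z (plane_wave k) = of_real (2 * pi) * \<i> ^ nat \<bar>j\<bar> * of_real (besP (nat \<bar>j\<bar>) z)
    * cis (- of_int j * polar_angle (freq_vec k)) * of_real (bessel_quot (int (nat \<bar>j\<bar>)) z (pi * norm (freq_vec k)))"
proof -
  define n where "n = nat \<bar>j\<bar>"
  define a where "a = pi * norm (freq_vec k)"
  define \<Phi> where "\<Phi> = polar_angle (freq_vec k)"
  have \<Phi>: "\<bar>\<Phi>\<bar> \<le> 2 * pi"
    using Arg_bounded[of "Complex (fst (freq_vec k)) (snd (freq_vec k))"]
    by (auto simp: \<Phi>_def polar_angle_def abs_le_iff)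
  have fv: "of_int (fst k) = norm (freq_vec k) * cos \<Phi>" "of_int (snd k) = norm (freq_vec k) * sin \<Phi>"
    using polar_decomposition[of "freq_vec k"] by (simp_all add: \<Phi>_def from_polar_def freq_vec_def prod_eq_iff)
  have wave: "plane_wave k (from_polar r \<theta>) = cis (a * r * cos (\<theta> - \<Phi>))" for r \<theta>
    by (simp add: plane_wave_def wave_def cis_mult from_polar_def fv a_def cos_diff algebra_simps)
  have ang: "integral {0..2 * pi} (\<lambda>\<theta>. cis (- of_int j * \<theta>) * plane_wave k (from_polar r \<theta>))
     = cis (- of_int j * \<Phi>) * (of_real (2 * pi) * \<i> ^ n * of_real (besJ n (a * r)))" for r
  proof -
    define G where "G p = cis (a * fst p)" for p :: "real \<times> real"
    have G: "continuous_on UNIV G"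
      unfolding G_def cis_conv_exp by (intro continuous_intros)
    have Gp: "G (from_polar r t) = cis (a * r * cos t)" for t
      by (simp add: G_def from_polar_def mult.assoc)
    have "integral {0..2 * pi} (\<lambda>\<theta>. cis (- of_int j * \<theta>) * plane_wave k (from_polar r \<theta>))
      = integral {0..2 * pi} (\<lambda>\<theta>. cis (- of_int j * \<theta>) * G (from_polar r (\<theta> + - \<Phi>)))"
      by (simp add: wave Gp)
    also have "\<dots> = cis (of_int j * - \<Phi>) * integral {0..2 * pi} (\<lambda>\<theta>. cis (- of_int j * \<theta>) * G (from_polar r \<theta>))"
      by (rule polar_angular_shift[OF G]) (use \<Phi> in simp)
    also have "integral {0..2 * pi} (\<lambda>\<theta>. cis (- of_int j * \<theta>) * G (from_polar r \<theta>))
       = of_real (2 * pi) * \<i> ^ n * of_real (besJ n (a * r))"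
      using bessel_integral[of "a * r" j]
      by (intro integral_unique) (simp add: Gp n_def mult.commute)
    finally show ?thesis by simp
  qed
  have "a \<ge> 0" by (simp add: a_def)
  have "((\<lambda>r. complex_of_real (r * (besJ n (z * r) * besJ n (a * r)))) has_integral
      complex_of_real (besP n z * bessel_quot (int n) z a)) {0..1}"
    unfolding n_def by (intro has_integral_of_real radial_integral z \<open>a \<ge> 0\<close>)
  from has_integral_mult_right[OF this, of "cis (- of_int j * \<Phi>) * (of_real (2 * pi) * \<i> ^ n)"]
  have "integral {0..1} (\<lambda>r. of_real (r * besJ n (z * r)) * (cis (- of_int j * \<Phi>) * (of_real (2 * pi) * \<i> ^ n * of_real (besJ n (a * r)))))
     = cis (- of_int j * \<Phi>) * (of_real (2 * pi) * \<i> ^ n) * of_real (besP n z * bessel_quot (int n) z a)"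
    by (intro integral_unique) (simp add: mult_ac)
  then show ?thesis
    unfolding polar_integral_iterated[OF continuous_on_plane_wave] ang n_def[symmetric] a_def[symmetric] \<Phi>_def[symmetric]
    by (simp add: mult_ac)
qed

section \<open>Negative orders and the Fourier-Bessel coefficients\<close>

text \<open>A nonzero factor independent of \<open>x\<close> is all that is needed to transfer zeros
  and quotients from order |m| to order \<open>m\<close>.\<close>

lemma bessel_J_abs: "\<exists>s. s \<noteq> 0 \<and> (\<forall>x. bessel_J m x = s * besJ (nat \<bar>m\<bar>) x)"
proof (cases "m \<ge> 0")
  case True
  then show ?thesis
    using bessel_J_of_nat[of "nat m"] by (intro exI[of _ 1]) simp
next
  case False
  then show ?thesis
    using bessel_J_minus[of "nat \<bar>m\<bar>"] by (intro exI[of _ "(-1) ^ nat \<bar>m\<bar>"]) simp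
qed

lemma bessel_zero_abs: "bessel_zero m n = bessel_zero (int (nat \<bar>m\<bar>)) n"
proof -
  obtain s where "s \<noteq> 0" "\<And>x. bessel_J m x = s * besJ (nat \<bar>m\<bar>) x"
    using bessel_J_abs by blast
  then show ?thesis
    unfolding bessel_zero_def bessel_J_of_nat by simp
qed

lemma bessel_zero_props:
  assumes "n \<ge> 1"
  shows "bessel_zero m n > 0" "besJ (nat \<bar>m\<bar>) (bessel_zero m n) = 0"
  using bessel_zero_of_nat[OF assms, of "nat \<bar>m\<bar>"] bessel_zero_abs[of m n] by auto

lemma bessel_quot_abs: "\<exists>s. \<forall>z a. bessel_quot m z a = s * bessel_quot (int (nat \<bar>m\<bar>)) z a"
proof -
  obtain s where s: "\<And>x. bessel_J m x = s * besJ (nat \<bar>m\<bar>) x"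
    using bessel_J_abs by blast
  then have J: "bessel_J m = (\<lambda>x. s * besJ (nat \<bar>m\<bar>) x)" by auto
  have "deriv (bessel_J m) z = s * deriv (bessel_J (int (nat \<bar>m\<bar>))) z" for z
  proof -
    have "deriv (bessel_J m) z = s * besD (nat \<bar>m\<bar>) z"
      unfolding J by (intro DERIV_imp_deriv DERIV_cmult DERIV_besJ)
    moreover have "deriv (bessel_J (int (nat \<bar>m\<bar>))) z = besD (nat \<bar>m\<bar>) z"
      unfolding bessel_J_of_nat[abs_def] by (rule DERIV_imp_deriv[OF DERIV_besJ])
    ultimately show ?thesis by simp
  qed
  then show ?thesis
    unfolding bessel_quot_def s bessel_J_of_nat by (intro exI[of _ s]) simp
qed

text \<open>Both sides depend on \<open>k\<close> through the same phase and the same Bessel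
  quotient; all other factors go into \<open>\<kappa>\<close>. Dividing by them is possible because
  zeros are simple, so \<open>besP\<close> does not vanish at z.\<close>

lemma fb_coeff_eq_polar_integral:
  assumes n: "n \<ge> 1"
  shows "\<exists>\<kappa>. \<forall>k. fb_coeff k m n = \<kappa> * polar_integral m (bessel_zero m n) (plane_wave k)"
proof -
  define z where "z = bessel_zero m n"
  define l where "l = nat \<bar>m\<bar>"
  have z: "z > 0" "besJ l z = 0"
    using bessel_zero_props[OF n] by (auto simp: z_def l_def)
  have P: "besP l z \<noteq> 0"
    using besJ_simple_zero[OF z] z by (simp add: besP_eq)
  obtain s where s: "\<And>z a. bessel_quot m z a = s * bessel_quot (int l) z a"
    using bessel_quot_abs[of m] unfolding l_def by blast
  define u where "u = complex_of_real (2 * pi) * \<i> ^ l * of_real (besP l z)"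
  have u: "u \<noteq> 0" using P by (simp add: u_def)
  define \<kappa> where "\<kappa> = fb_eps m * of_real (sqrt pi) * (-1) ^ n * \<i> powi m * of_real z * of_real s / (2 * u)"
  have "fb_coeff k m n = \<kappa> * polar_integral m z (plane_wave k)" for k
  proof -
    have e: "exp (- \<i> * of_int m * of_real (polar_angle (freq_vec k))) = cis (- of_int m * polar_angle (freq_vec k))"
      by (simp add: cis_conv_exp mult.assoc)
    have I: "polar_integral m z (plane_wave k)
      = u * cis (- of_int m * polar_angle (freq_vec k)) * of_real (bessel_quot (int l) z (pi * norm (freq_vec k)))"
      using polar_integral_plane_wave[of z m k] z by (simp add: u_def l_def)
    show ?thesis
      unfolding I fb_coeff_def z_def[symmetric] s e \<kappa>_def using u by (simp add: field_simps)
  qed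
  then show ?thesis unfolding z_def by blast
qed

text \<open>By linearity the transform is \<open>4 * \<kappa>\<close> times the polar integral of
  the interpolant. The integrals of \<open>f\<close> and of the rotated \<open>f\<close> differ
  exactly by \<open>cis (m * \<phi>)\<close>, so only the two interpolation errors remain.\<close>

lemma fb_transform_rotation_error:
  assumes f: "C_diff 2 f" "supported_in f (ball 0 1)" and n: "n \<ge> 1" and \<phi>: "0 \<le> \<phi>" "\<phi> < 2 * pi"
  shows "\<exists>D. \<forall>K\<ge>1. norm (fb_transform K m n (f \<circ> rot \<phi>) - cis (of_int m * \<phi>) * fb_transform K m n f) \<le> D / real K"
proof -
  obtain C where C: "\<And>\<phi>. smooth_bump C (f \<circ> rot \<phi>)"
    using smooth_bump_rot[OF f] by blast
  have "f \<circ> rot 0 = f" by (auto simp: rot_def)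
  then have C0: "smooth_bump C f" using C[of 0] by simp
  define I where "I = polar_integral m (bessel_zero m n)"
  obtain \<kappa> where \<kappa>: "\<And>k. fb_coeff k m n = \<kappa> * I (plane_wave k)"
    using fb_coeff_eq_polar_integral[OF n] unfolding I_def by blast
  obtain B where B: "\<And>F b. continuous_on UNIV F \<Longrightarrow> (\<And>p. norm p \<le> 1 \<Longrightarrow> norm (F p) \<le> b) \<Longrightarrow> norm (I F) \<le> B * b"
    using polar_integral_bound[of m "bessel_zero m n"] unfolding I_def by blast
  have transform: "fb_transform K m n g = 4 * \<kappa> * I (interp K g)" for K g
  proof -
    have "interp K g = (\<lambda>p. \<Sum>k\<in>freq_box K. (fin_fourier g k (2 * K + 1) / 4) * plane_wave k p)"
      by (auto simp: interp_def sum_divide_distrib)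
    then have "I (interp K g) = (\<Sum>k\<in>freq_box K. (fin_fourier g k (2 * K + 1) / 4) * I (plane_wave k))"
      unfolding I_def by (simp only:) (intro polar_integral_sum finite_freq_box continuous_on_plane_wave)
    then show ?thesis
      by (simp add: fb_transform_def \<kappa> freq_box_def sum_distrib_left mult_ac)
  qed
  have err: "norm (I (interp K g) - I g) \<le> B * (13 * C / real K)" if "smooth_bump C g" "K \<ge> 1" for K g
  proof -
    have g: "continuous_on UNIV g" using that by (simp add: smooth_bump_def)
    have "I (interp K g) - I g = I (\<lambda>p. interp K g p - g p)"
      unfolding I_def by (rule polar_integral_diff[symmetric]) (intro continuous_on_interp g)+
    also have "norm \<dots> \<le> B * (13 * C / real K)"
      by (intro B continuous_intros continuous_on_interp g interp_error that)
    finally show ?thesis .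
  qed
  have cont: "continuous_on UNIV f" using C0 by (simp add: smooth_bump_def)
  have rot: "I (f \<circ> rot \<phi>) = cis (of_int m * \<phi>) * I f"
    unfolding I_def using \<phi> by (intro polar_integral_rot cont) simp
  have "norm (fb_transform K m n (f \<circ> rot \<phi>) - cis (of_int m * \<phi>) * fb_transform K m n f)
      \<le> (4 * norm \<kappa> * (2 * (B * (13 * C)))) / real K" if K: "K \<ge> 1" for K
  proof -
    have "fb_transform K m n (f \<circ> rot \<phi>) - cis (of_int m * \<phi>) * fb_transform K m n f
      = 4 * \<kappa> * ((I (interp K (f \<circ> rot \<phi>)) - I (f \<circ> rot \<phi>)) - cis (of_int m * \<phi>) * (I (interp K f) - I f))"
      unfolding transform rot by (simp add: algebra_simps)
    also have "norm \<dots> \<le> 4 * norm \<kappa> * (B * (13 * C / real K) + B * (13 * C / real K))"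
      unfolding norm_mult[of "4 * \<kappa>"] norm_mult[of 4]
      by (intro mult_mono order_trans[OF norm_triangle_ineq4] add_mono err C K)
         (use err[OF C0 K] in \<open>auto simp: norm_mult\<close>)
    finally show ?thesis by (simp add: field_simps)
  qed
  then show ?thesis by blast
qed

lemma fb_Psi_rot: "fb_Psi m n (rot \<phi> p) = cis (of_int m * \<phi>) * fb_Psi m n p"
proof (cases "p = 0")
  case True
  then have "rot \<phi> p = 0" by (simp add: rot_def zero_prod_def)
  moreover have "bessel_J m 0 = 0" if "m \<noteq> 0"
    using bessel_J_abs[of m] that by (auto simp: besJ_0)
  ultimately show ?thesis
    using True by (cases "m = 0") (auto simp: fb_Psi_def)
next
  case False
  define q where "q = rot \<phi> p"
  have cis_angle: "cis (polar_angle u) = sgn (Complex (fst u) (snd u))" if "u \<noteq> 0" for u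
    unfolding polar_angle_def by (rule cis_Arg) (use that in \<open>auto simp: complex_eq_iff prod_eq_iff\<close>)
  have "q \<noteq> 0" using False norm_rot[of \<phi> p] unfolding q_def by auto
  have "Complex (fst q) (snd q) = cis \<phi> * Complex (fst p) (snd p)"
    by (simp add: q_def rot_def complex_eq_iff algebra_simps)
  then have "cis (polar_angle q) = cis \<phi> * cis (polar_angle p)"
    using cis_angle[OF \<open>q \<noteq> 0\<close>] cis_angle[OF False] by (simp add: sgn_mult)
  \<comment> \<open>Angles add only modulo 2 pi; taking an integer power of \<open>cis\<close>
    avoids that ambiguity.\<close>
  then have "cis (polar_angle q) powi m = (cis \<phi> * cis (polar_angle p)) powi m" by simp
  then have "cis (of_int m * polar_angle q) = cis (of_int m * \<phi>) * cis (of_int m * polar_angle p)"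
    by (simp add: cis_power_int power_int_mult_distrib)
  moreover have "exp (\<i> * of_int m * of_real x) = cis (of_int m * x)" for x
    by (simp add: cis_conv_exp mult.assoc)
  ultimately show ?thesis
    by (simp add: fb_Psi_def norm_rot q_def mult_ac)
qed

lemma fb_Psi_bounded: "\<exists>B. \<forall>p. norm (fb_Psi m n p) \<le> B"
proof -
  obtain s where s: "\<And>x. bessel_J m x = s * besJ (nat \<bar>m\<bar>) x"
    using bessel_J_abs by blast
  define z where "z = bessel_zero m n"
  have "bounded ((\<lambda>t. bessel_J m (z * t)) ` {0..1})"
    unfolding s by (intro compact_imp_bounded compact_continuous_image continuous_intros compact_Icc)
  then obtain b where "\<forall>t\<in>{0..1}. \<bar>bessel_J m (z * t)\<bar> \<le> b"
    unfolding bounded_iff by auto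
  then have b: "\<bar>bessel_J m (z * t)\<bar> \<le> b" if "t \<in> {0..1}" for t
    using that by blast
  define d where "d = sqrt pi * \<bar>bessel_J (m + 1) z\<bar>"
  have d: "d \<ge> 0" by (simp add: d_def)
  have b0: "b \<ge> 0" using b[of 0] by force
  \<comment> \<open>If \<open>d = 0\<close>, both sides are 0 by the convention for
    division.\<close>
  have "norm (fb_Psi m n p) \<le> b / d" for p
  proof (cases "norm p \<le> 1")
    case True
    have "norm (exp (\<i> * of_int m * of_real (polar_angle p))) = 1"
      by simp
    then have "norm (fb_Psi m n p) = \<bar>bessel_J m (z * norm p)\<bar> / d"
      using True d by (simp add: fb_Psi_def norm_mult norm_divide z_def[symmetric] d_def[symmetric] del: of_real_mult)
    also have "\<dots> \<le> b / d"
      using True d by (intro divide_right_mono b) auto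
    finally show ?thesis .
  next
    case False
    then show ?thesis using b0 d by (simp add: fb_Psi_def)
  qed
  then show ?thesis by blast
qed

theorem mainTheorem6:
  fixes f :: "real \<times> real \<Rightarrow> complex" and M N :: nat and \<phi> :: real
  assumes "C_diff 2 f"
    and "supported_in f (ball 0 1)"
    and "M \<ge> 1" and "N \<ge> 1"
    and "0 \<le> \<phi>" and "\<phi> < 2 * pi"
  shows "\<exists>A::real. A > 0 \<and>
    (\<forall>K::nat. K \<ge> 1 \<and> int K \<ge> K_max M N \<longrightarrow>
       sup_norm (\<lambda>p. fb_inverse M N K (rotate_fun \<phi> f) p - rotate_fun \<phi> (fb_inverse M N K f) p)
         \<le> ereal (A / real K))"
proof -
  \<comment> \<open>The condition \<open>n \<ge> 1\<close> is built into \<open>P\<close> so that a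
    constant can be chosen for every pair of indices.\<close>
  define P where "P m n d \<longleftrightarrow> (\<forall>K. n \<ge> 1 \<longrightarrow> K \<ge> 1 \<longrightarrow>
      norm (fb_transform K m n (f \<circ> rot \<phi>) - cis (of_int m * \<phi>) * fb_transform K m n f) \<le> d / real K)" for m n d
  have "\<exists>d. P m n d" for m n
    unfolding P_def using fb_transform_rotation_error[OF assms(1,2) _ assms(5,6), of n m] by blast
  then obtain D where "\<And>m n. P m n (D m n)"
    by metis
  then have D: "norm (fb_transform K m n (f \<circ> rot \<phi>) - cis (of_int m * \<phi>) * fb_transform K m n f) \<le> D m n / real K"
    if "n \<ge> 1" "K \<ge> 1" for m n K
    using that unfolding P_def by blast
  obtain B where B: "\<And>m n p. norm (fb_Psi m n p) \<le> B m n"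
    using fb_Psi_bounded by metis
  define A where "A = (\<Sum>m = - int M..int M. \<Sum>n = 1..N. D m n * B m n)"
  have bound: "norm (fb_inverse M N K (rotate_fun \<phi> f) p - rotate_fun \<phi> (fb_inverse M N K f) p) \<le> A / real K"
    if K: "K \<ge> 1" for K p
  proof -
    have "fb_inverse M N K (rotate_fun \<phi> f) p - rotate_fun \<phi> (fb_inverse M N K f) p
      = (\<Sum>m = - int M..int M. \<Sum>n = 1..N. (fb_transform K m n (f \<circ> rot \<phi>) - cis (of_int m * \<phi>) * fb_transform K m n f) * fb_Psi m n p)"
      unfolding rotate_fun_eq o_def[of "fb_inverse M N K f"] fb_inverse_def fb_Psi_rot sum_subtractf[symmetric]
      by (intro sum.cong refl) (simp add: algebra_simps)
    also have "norm \<dots> \<le> (\<Sum>m = - int M..int M. \<Sum>n = 1..N. D m n / real K * B m n)"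
    proof (intro order_trans[OF norm_sum] sum_mono)
      fix m n assume "n \<in> {1..N}"
      then have n: "n \<ge> 1" by simp
      show "norm ((fb_transform K m n (f \<circ> rot \<phi>) - cis (of_int m * \<phi>) * fb_transform K m n f) * fb_Psi m n p)
          \<le> D m n / real K * B m n"
        unfolding norm_mult using order_trans[OF norm_ge_zero D[OF n K, of m]]
        by (intro mult_mono D n K B) auto
    qed
    also have "\<dots> = A / real K"
      by (simp add: A_def sum_divide_distrib)
    finally show ?thesis .
  qed
  show ?thesis
  \<comment> \<open>Adding 1 makes the constant strictly positive even when
    \<open>A = 0\<close>.\<close>
  proof (intro exI[of _ "\<bar>A\<bar> + 1"] conjI allI impI)
    fix K assume "1 \<le> K \<and> K_max M N \<le> int K"
    then have K: "K \<ge> 1" by simp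
    have "A / real K \<le> (\<bar>A\<bar> + 1) / real K"
      by (intro divide_right_mono) auto
    then show "sup_norm (\<lambda>p. fb_inverse M N K (rotate_fun \<phi> f) p - rotate_fun \<phi> (fb_inverse M N K f) p)
         \<le> ereal ((\<bar>A\<bar> + 1) / real K)"
      unfolding sup_norm_def using bound[OF K] by (intro SUP_least) (auto intro: order_trans)
  qed auto
qed

end
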